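(* Let $X$ be a projective curve over a finite field $k$ of $q$ elements. Let $k'$ be a finite extension of $k$, let $X'=X\times_{\operatorname{Spec}k}\operatorname{Spec}k'$, and let $\mathcal{L}_{X'}$ be the pull-back of $\mathcal{L}_X$ to $X'$. Let $i$ be a positive integer, and let $D$ be an effective divisor on $X'$. Let $M$ be the matrix of the inclusion map $$\Gamma(X',\mathcal{L}_{X'}^{\otimes i}(-D))\longrightarrow\Gamma(X',\mathcal{L}_{X'}^{\otimes i})$$ with respect to any $k'$-basis of the left-hand side and the $k'$-basis of the right-hand side induced from any $k$-basis of $\Gamma(X,\mathcal{L}_X^{\otimes i})$. Then the algorithm that, given $M$, applies the Frobenius automorphism $a\mapsto a^q$ of $k'$ over $k$ to the coefficients of $M$ outputs the analogous matrix for the inclusion map $$\Gamma(X',\mathcal{L}_{X'}^{\otimes i}(-\mathrm{F}_q(D)))\longrightarrow\Gamma(X',\mathcal{L}_{X'}^{\otimes i}),$$ that is, its matrix with respect to some $k'$-basis of the left-hand side and the same $k'$-basis of the right-hand side. The algorithm takes $O((\deg\mathcal{L}_X)^2)$ computations of a $q$-th power of an element of $k'$.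
   Context: A "projective curve" over a field $k$ means a complete, smooth, geometrically connected curve $X$ over $k$, of genus $g_X\ge 0$, together with a chosen line bundle $\mathcal{L}_X$ with $\deg\mathcal{L}_X\ge 2g_X+1$. For an effective divisor $D$ on $X'$, $\Gamma(X',\mathcal{L}_{X'}^{\otimes i}(-D))$ is the subspace of sections vanishing on $D$; and $\Gamma(X',\mathcal{L}_{X'}^{\otimes i})=k'\otimes_k\Gamma(X,\mathcal{L}_X^{\otimes i})$. An effective divisor $D$ of degree $d$ on $X'$ corresponds to a $k'$-rational point of the symmetric power $\operatorname{Sym}^dX$ of $X$ over $k$. The divisor $\mathrm{F}_q(D)$ on $X'$ is the one corresponding to the image of this point under the $q$-power Frobenius endomorphism of the $k$-variety $\operatorname{Sym}^dX$; over an algebraic closure, if $D=\sum_jP_j$, then $\mathrm{F}_q(D)=\sum_j\mathrm{F}_q(P_j)$ with $\mathrm{F}_q$ the $q$-power Frobenius map on points of $X$. *)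

theory Defs
  imports
    "HOL-Algebra.Algebraic_Closure_Type"
    "HOL-Analysis.Abstract_Topology"
    "HOL-Library.FuncSet"
    "HOL-Library.Multiset"
begin

text \<open>
  Varieties over a perfect field \<open>K\<close> are treated classically: the type \<open>'a\<close> is an algebraic closure
  of \<open>K\<close>, the field \<open>K\<close> is a subset of \<open>'a\<close>, and a projective variety over \<open>K\<close> is the set of its
  points over \<open>'a\<close>, a subset of projective space that is the zero set of forms with coefficients
  in \<open>K\<close>. Base change to a larger field \<open>K'\<close> does not change the set of points; it enlarges
  the set of open subsets and of regular functions, so these notions take the field as an argument.
\<close>

section \<open>Projective space, Zariski topology, regular functions\<close>

type_synonym 'a point = "(nat \<Rightarrow> 'a) set"

definition proj_space :: "nat \<Rightarrow> 'a::field point set" where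
  "proj_space n =
     {P. \<exists>x. (\<exists>i\<le>n. x i \<noteq> 0) \<and> (\<forall>i>n. x i = 0) \<and> P = {\<lambda>i. c * x i | c. c \<noteq> 0}}"

definition exponents :: "nat \<Rightarrow> nat \<Rightarrow> (nat \<Rightarrow> nat) set" where
  "exponents n d = {m. (\<forall>i>n. m i = 0) \<and> (\<Sum>i\<le>n. m i) = d}"

text \<open>Homogeneous polynomials of degree \<open>d\<close> in \<open>x\<^sub>0, \<dots>, x\<^sub>n\<close> with coefficients in \<open>K\<close>, as
  functions; over an infinite field a polynomial is determined by its function.\<close>

definition forms :: "'a::field set \<Rightarrow> nat \<Rightarrow> nat \<Rightarrow> ((nat \<Rightarrow> 'a) \<Rightarrow> 'a) set" where
  "forms K n d =
     {\<lambda>x. \<Sum>m\<in>exponents n d. c m * (\<Prod>i\<le>n. x i ^ m i) | c. range c \<subseteq> K}"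

definition basic_open :: "nat \<Rightarrow> ((nat \<Rightarrow> 'a) \<Rightarrow> 'a::field) \<Rightarrow> 'a point set" where
  "basic_open n F = {P \<in> proj_space n. \<forall>x\<in>P. F x \<noteq> 0}"

definition zariski :: "'a::field set \<Rightarrow> nat \<Rightarrow> 'a point topology" where
  "zariski K n = topology_generated_by {basic_open n F | F d. F \<in> forms K n d}"

definition regular_on :: "'a::field set \<Rightarrow> nat \<Rightarrow> 'a point set \<Rightarrow> ('a point \<Rightarrow> 'a) \<Rightarrow> bool" where
  "regular_on K n U f \<longleftrightarrow>
     (\<forall>P\<in>U. \<exists>d. \<exists>F\<in>forms K n d. \<exists>G\<in>forms K n d.
        (\<forall>x\<in>P. G x \<noteq> 0) \<and> (\<forall>Q\<in>U. \<forall>x\<in>Q. G x \<noteq> 0 \<longrightarrow> f Q = F x / G x))"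

section \<open>Local rings at geometric points and order of vanishing\<close>

abbreviation geom_top :: "nat \<Rightarrow> 'a::field point set \<Rightarrow> 'a point topology" where
  "geom_top n C \<equiv> subtopology (zariski UNIV n) C"

definition regular_at :: "nat \<Rightarrow> 'a::field point set \<Rightarrow> 'a point \<Rightarrow> ('a point \<Rightarrow> 'a) \<Rightarrow> bool" where
  "regular_at n C P f \<longleftrightarrow> (\<exists>W. openin (geom_top n C) W \<and> P \<in> W \<and> regular_on UNIV n W f)"

definition eq_near ::
  "nat \<Rightarrow> 'a::field point set \<Rightarrow> 'a point \<Rightarrow> ('a point \<Rightarrow> 'a) \<Rightarrow> ('a point \<Rightarrow> 'a) \<Rightarrow> bool" where
  "eq_near n C P f h \<longleftrightarrow> (\<exists>W. openin (geom_top n C) W \<and> P \<in> W \<and> (\<forall>Q\<in>W. f Q = h Q))"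

text \<open>The functions whose germ lies in the \<open>m\<close>-th power of the maximal ideal of \<open>\<O>\<^bsub>C,P\<^esub>\<close>.\<close>

primrec max_ideal_power ::
  "nat \<Rightarrow> 'a::field point set \<Rightarrow> 'a point \<Rightarrow> nat \<Rightarrow> ('a point \<Rightarrow> 'a) set" where
  "max_ideal_power n C P 0 = {f. regular_at n C P f}"
| "max_ideal_power n C P (Suc m) =
     {f. regular_at n C P f \<and>
        (\<exists>(N::nat) g h.
           (\<forall>j<N. g j \<in> max_ideal_power n C P m \<and> regular_at n C P (h j) \<and> h j P = 0) \<and>
           eq_near n C P f (\<lambda>Q. \<Sum>j<N. g j Q * h j Q))}"

definition germ_order :: "nat \<Rightarrow> 'a::field point set \<Rightarrow> 'a point \<Rightarrow> ('a point \<Rightarrow> 'a) \<Rightarrow> nat \<Rightarrow> bool" where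
  "germ_order n C P f m \<longleftrightarrow>
     f \<in> max_ideal_power n C P m \<and> f \<notin> max_ideal_power n C P (Suc m)"

text \<open>For a function \<open>f\<close> on the dense open subset \<open>V\<close> of the curve \<open>C\<close>: \<open>f\<close> has order \<open>z\<close> at \<open>P\<close>,
  where \<open>P\<close> need not lie in \<open>V\<close>.\<close>

definition rational_order ::
  "nat \<Rightarrow> 'a::field point set \<Rightarrow> 'a point set \<Rightarrow> 'a point \<Rightarrow> ('a point \<Rightarrow> 'a) \<Rightarrow> int \<Rightarrow> bool" where
  "rational_order n C V P f z \<longleftrightarrow>
     (\<exists>g h W a b. openin (geom_top n C) W \<and> P \<in> W \<and>
        germ_order n C P g a \<and> germ_order n C P h b \<and>
        (\<forall>Q\<in>V \<inter> W. f Q * h Q = g Q) \<and> z = int a - int b)"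

section \<open>Curves\<close>

definition irreducible_in :: "'b topology \<Rightarrow> 'b set \<Rightarrow> bool" where
  "irreducible_in T Z \<longleftrightarrow>
     Z \<noteq> {} \<and> (\<forall>A B. closedin T A \<and> closedin T B \<and> Z \<subseteq> A \<union> B \<longrightarrow> Z \<subseteq> A \<or> Z \<subseteq> B)"

definition irreducible_chain :: "'b topology \<Rightarrow> 'b set list \<Rightarrow> bool" where
  "irreducible_chain T Zs \<longleftrightarrow>
     sorted_wrt (\<subset>) Zs \<and> (\<forall>Z\<in>set Zs. closedin T Z \<and> irreducible_in T Z)"

definition krull_dimension :: "'b topology \<Rightarrow> nat \<Rightarrow> bool" where
  "krull_dimension T r \<longleftrightarrow>
     (\<exists>Zs. irreducible_chain T Zs \<and> length Zs = r + 1) \<and>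
     (\<forall>Zs. irreducible_chain T Zs \<longrightarrow> length Zs \<le> r + 1)"

text \<open>A connected one-dimensional \<open>C\<close> is smooth at \<open>P\<close> iff the local ring at the geometric point \<open>P\<close>
  is regular of dimension one, that is, iff its maximal ideal is generated by one element.\<close>

definition smooth_curve_at :: "nat \<Rightarrow> 'a::field point set \<Rightarrow> 'a point \<Rightarrow> bool" where
  "smooth_curve_at n C P \<longleftrightarrow>
     (\<exists>t. regular_at n C P t \<and> t P = 0 \<and>
        (\<forall>f. regular_at n C P f \<and> f P = 0 \<longrightarrow>
           (\<exists>h. regular_at n C P h \<and> eq_near n C P f (\<lambda>Q. t Q * h Q))))"

text \<open>Completeness is built in: \<open>C\<close> is closed in projective space, and every complete curve
  is projective.\<close>

definition smooth_complete_curve :: "'a::field set \<Rightarrow> nat \<Rightarrow> 'a point set \<Rightarrow> bool" where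
  "smooth_complete_curve K n C \<longleftrightarrow>
     closedin (zariski K n) C \<and> C \<noteq> {} \<and>
     connectedin (zariski UNIV n) C \<and>
     krull_dimension (geom_top n C) 1 \<and>
     (\<forall>P\<in>C. smooth_curve_at n C P)"

subsection \<open>Genus\<close>

text \<open>The genus is the dimension over \<open>K\<close> of \<open>H\<^sup>1(C, \<O>\<^sub>C)\<close>, computed as Cech cohomology of the
  affine open cover by the sets where one coordinate does not vanish.\<close>

definition coord_chart :: "'a::field point set \<Rightarrow> nat \<Rightarrow> 'a point set" where
  "coord_chart C i = {P \<in> C. \<forall>x\<in>P. x i \<noteq> 0}"

definition cech_cocycles :: "'a::field set \<Rightarrow> nat \<Rightarrow> 'a point set \<Rightarrow> (nat \<Rightarrow> nat \<Rightarrow> 'a point \<Rightarrow> 'a) set" where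
  "cech_cocycles K n C =
     {f. (\<forall>i\<le>n. \<forall>j\<le>n. regular_on K n (coord_chart C i \<inter> coord_chart C j) (f i j)) \<and>
         (\<forall>i\<le>n. \<forall>j\<le>n. \<forall>l\<le>n. \<forall>P\<in>coord_chart C i \<inter> coord_chart C j \<inter> coord_chart C l.
            f i l P = f i j P + f j l P)}"

definition cech_coboundaries :: "'a::field set \<Rightarrow> nat \<Rightarrow> 'a point set \<Rightarrow> (nat \<Rightarrow> nat \<Rightarrow> 'a point \<Rightarrow> 'a) set" where
  "cech_coboundaries K n C =
     {f. \<exists>u. (\<forall>i\<le>n. regular_on K n (coord_chart C i) (u i)) \<and>
         (\<forall>i\<le>n. \<forall>j\<le>n. \<forall>P\<in>coord_chart C i \<inter> coord_chart C j. f i j P = u j P - u i P)}"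

definition has_genus :: "'a::field set \<Rightarrow> nat \<Rightarrow> 'a point set \<Rightarrow> nat \<Rightarrow> bool" where
  "has_genus K n C g \<longleftrightarrow>
     (\<exists>c. (\<forall>r<g. c r \<in> cech_cocycles K n C) \<and>
        (\<forall>f\<in>cech_cocycles K n C. \<exists>!a. a \<in> {..<g} \<rightarrow>\<^sub>E K \<and>
           (\<lambda>i j P. f i j P - (\<Sum>r<g. a r * c r i j P)) \<in> cech_coboundaries K n C))"

section \<open>Line bundles\<close>

text \<open>A line bundle is given by a finite open cover \<open>U\<^sub>0, \<dots>, U\<^bsub>N-1\<^esub>\<close> and transition functions
  \<open>g\<^bsub>ab\<^esub>\<close>; a section is a family of functions with \<open>s\<^sub>a = g\<^bsub>ab\<^esub> s\<^sub>b\<close> on \<open>U\<^sub>a \<inter> U\<^sub>b\<close>. The pull-back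
  to a larger base field is given by the same data.\<close>

record 'a line_bundle =
  num_charts :: nat
  chart :: "nat \<Rightarrow> 'a point set"
  transition :: "nat \<Rightarrow> nat \<Rightarrow> 'a point \<Rightarrow> 'a"

definition is_line_bundle :: "'a::field set \<Rightarrow> nat \<Rightarrow> 'a point set \<Rightarrow> 'a line_bundle \<Rightarrow> bool" where
  "is_line_bundle K n C L \<longleftrightarrow>
     (\<forall>a<num_charts L. openin (subtopology (zariski K n) C) (chart L a)) \<and>
     (\<Union>a<num_charts L. chart L a) = C \<and>
     (\<forall>a<num_charts L. \<forall>b<num_charts L.
        regular_on K n (chart L a \<inter> chart L b) (transition L a b) \<and>
        (\<forall>P\<in>chart L a \<inter> chart L b. transition L a b P \<noteq> 0)) \<and>
     (\<forall>a<num_charts L. \<forall>b<num_charts L. \<forall>c<num_charts L.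
        \<forall>P\<in>chart L a \<inter> chart L b \<inter> chart L c.
          transition L a c P = transition L a b P * transition L b c P)"

definition tensor_power :: "'a::field line_bundle \<Rightarrow> nat \<Rightarrow> 'a line_bundle" where
  "tensor_power L i = L\<lparr>transition := \<lambda>a b P. transition L a b P ^ i\<rparr>"

type_synonym 'a sect = "nat \<Rightarrow> 'a point \<Rightarrow> 'a"

text \<open>\<open>\<Gamma>(C\<^sub>K, L)\<close>. The values outside the charts are set to zero, so that equality of sections is
  equality of functions.\<close>

definition global_sections :: "'a::field set \<Rightarrow> nat \<Rightarrow> 'a line_bundle \<Rightarrow> 'a sect set" where
  "global_sections K n L =
     {s. (\<forall>a<num_charts L. regular_on K n (chart L a) (s a)) \<and>
         (\<forall>a<num_charts L. \<forall>b<num_charts L. \<forall>P\<in>chart L a \<inter> chart L b.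
            s a P = transition L a b P * s b P) \<and>
         (\<forall>a P. \<not> (a < num_charts L \<and> P \<in> chart L a) \<longrightarrow> s a P = 0)}"

text \<open>\<open>s\<close> is a rational section over the algebraic closure, defined on the non-empty open set \<open>V\<close>,
  and not zero.\<close>

definition nonzero_rational_section ::
  "nat \<Rightarrow> 'a::field point set \<Rightarrow> 'a line_bundle \<Rightarrow> 'a point set \<Rightarrow> 'a sect \<Rightarrow> bool" where
  "nonzero_rational_section n C L V s \<longleftrightarrow>
     openin (geom_top n C) V \<and>
     (\<forall>a<num_charts L. regular_on UNIV n (V \<inter> chart L a) (s a)) \<and>
     (\<forall>a<num_charts L. \<forall>b<num_charts L. \<forall>P\<in>V \<inter> chart L a \<inter> chart L b.
        s a P = transition L a b P * s b P) \<and>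
     (\<exists>a<num_charts L. \<exists>P\<in>V \<inter> chart L a. s a P \<noteq> 0)"

definition section_divisor ::
  "nat \<Rightarrow> 'a::field point set \<Rightarrow> 'a line_bundle \<Rightarrow> 'a point set \<Rightarrow> 'a sect \<Rightarrow> ('a point \<Rightarrow> int) \<Rightarrow> bool" where
  "section_divisor n C L V s E \<longleftrightarrow>
     (\<forall>P. P \<notin> C \<longrightarrow> E P = 0) \<and> finite {P. E P \<noteq> 0} \<and>
     (\<forall>a<num_charts L. \<forall>P\<in>chart L a. rational_order n C V P (s a) (E P))"

text \<open>The degree of a line bundle is the degree of the divisor of any non-zero rational section.\<close>

definition has_degree :: "nat \<Rightarrow> 'a::field point set \<Rightarrow> 'a line_bundle \<Rightarrow> int \<Rightarrow> bool" where
  "has_degree n C L d \<longleftrightarrow>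
     (\<exists>V s. nonzero_rational_section n C L V s) \<and>
     (\<forall>V s. nonzero_rational_section n C L V s \<longrightarrow>
        (\<exists>E. section_divisor n C L V s E \<and> (\<Sum>P | E P \<noteq> 0. E P) = d))"

definition projective_curve ::
  "'a::field set \<Rightarrow> nat \<Rightarrow> 'a point set \<Rightarrow> nat \<Rightarrow> 'a line_bundle \<Rightarrow> int \<Rightarrow> bool" where
  "projective_curve K n C g L d \<longleftrightarrow>
     smooth_complete_curve K n C \<and> has_genus K n C g \<and>
     is_line_bundle K n C L \<and> has_degree n C L d \<and> d \<ge> 2 * int g + 1"

section \<open>Effective divisors and Frobenius\<close>

definition map_point :: "('a \<Rightarrow> 'a) \<Rightarrow> 'a point \<Rightarrow> 'a point" where
  "map_point \<tau> P = (\<lambda>x. \<tau> \<circ> x) ` P"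

definition galois_group :: "'a::field set \<Rightarrow> ('a \<Rightarrow> 'a) set" where
  "galois_group K =
     {\<tau> \<in> ring_iso ring_of_type_algebra ring_of_type_algebra. \<forall>a\<in>K. \<tau> a = a}"

text \<open>Points of \<open>Sym\<^sup>d C\<close> over the algebraic closure are multisets of \<open>d\<close> points of \<open>C\<close>. Effective
  divisors of degree \<open>d\<close> on \<open>C\<^sub>K\<close> are the \<open>K\<close>-rational points of \<open>Sym\<^sup>d C\<close>, which for
  perfect \<open>K\<close> are the multisets fixed by the Galois group.\<close>

definition effective_divisor :: "'a::field set \<Rightarrow> 'a point set \<Rightarrow> 'a point multiset \<Rightarrow> bool" where
  "effective_divisor K C D \<longleftrightarrow>
     set_mset D \<subseteq> C \<and> (\<forall>\<tau>\<in>galois_group K. image_mset (map_point \<tau>) D = D)"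

definition frobenius_divisor :: "nat \<Rightarrow> 'a::field point multiset \<Rightarrow> 'a point multiset" where
  "frobenius_divisor q D = image_mset (map_point (\<lambda>a. a ^ q)) D"

text \<open>\<open>\<Gamma>(C\<^sub>K, L(-D))\<close> as a subspace of \<open>\<Gamma>(C\<^sub>K, L)\<close>.\<close>

definition sections_vanishing ::
  "'a::field set \<Rightarrow> nat \<Rightarrow> 'a point set \<Rightarrow> 'a line_bundle \<Rightarrow> 'a point multiset \<Rightarrow> 'a sect set" where
  "sections_vanishing K n C L D =
     {s \<in> global_sections K n L.
        \<forall>a<num_charts L. \<forall>P\<in>chart L a. s a \<in> max_ideal_power n C P (count D P)}"

section \<open>Bases, matrices and the algorithm\<close>

definition lin_comb :: "'a::field sect list \<Rightarrow> (nat \<Rightarrow> 'a) \<Rightarrow> 'a sect" where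
  "lin_comb e c = (\<lambda>a P. \<Sum>i<length e. c i * (e ! i) a P)"

definition is_basis :: "'a::field set \<Rightarrow> 'a sect set \<Rightarrow> 'a sect list \<Rightarrow> bool" where
  "is_basis K S e \<longleftrightarrow>
     set e \<subseteq> S \<and> (\<forall>s\<in>S. \<exists>!c. c \<in> {..<length e} \<rightarrow>\<^sub>E K \<and> s = lin_comb e c)"

text \<open>Matrices are lists of rows; the columns are the coordinates of the elements of \<open>b\<close> with
  respect to \<open>e\<close>.\<close>

definition inclusion_matrix ::
  "'a::field set \<Rightarrow> 'a sect list \<Rightarrow> 'a sect list \<Rightarrow> 'a list list \<Rightarrow> bool" where
  "inclusion_matrix K b e M \<longleftrightarrow>
     length M = length e \<and> (\<forall>r\<in>set M. length r = length b \<and> set r \<subseteq> K) \<and>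
     (\<forall>j<length b. b ! j = lin_comb e (\<lambda>i. M ! i ! j))"

text \<open>Computations return a result together with the number of \<open>q\<close>-th powers computed.\<close>

definition qth_power :: "nat \<Rightarrow> 'a::field \<Rightarrow> 'a \<times> nat" where
  "qth_power q a = (a ^ q, 1)"

fun map_counting :: "('b \<Rightarrow> 'c \<times> nat) \<Rightarrow> 'b list \<Rightarrow> 'c list \<times> nat" where
  "map_counting f [] = ([], 0)"
| "map_counting f (x # xs) =
     (let (y, s) = f x; (ys, t) = map_counting f xs in (y # ys, s + t))"

definition frobenius_matrix :: "nat \<Rightarrow> 'a::field list list \<Rightarrow> 'a list list \<times> nat" where
  "frobenius_matrix q = map_counting (map_counting (qth_power q))"

end

theory Submission
  imports Defs "HOL-Analysis.Abstract_Limits"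
begin

text \<open>
  The \<open>q\<close>-power map \<open>\<phi>\<close> is an automorphism of the algebraic closure fixing \<open>k\<close>, and it
  acts on sections by \<open>s \<mapsto> \<phi> \<circ> s \<circ> \<phi>\<^sup>-\<^sup>1\<close>. Everything defined over \<open>k\<close> is invariant, so this
  semilinear action carries \<open>\<Gamma>(L\<^sup>i(-D))\<close> onto \<open>\<Gamma>(L\<^sup>i(-F\<^sub>q(D)))\<close>, fixes the given \<open>k\<close>-basis, and
  hence acts on coordinates by \<open>a \<mapsto> a\<^sup>q\<close>.

  The number of entries is bounded by \<open>dim \<Gamma>(L\<^sup>i) \<le> i deg L + 1\<close>: among
  \<open>i deg L + 2\<close> linearly independent sections some non-zero combination over the algebraic
  closure vanishes to order \<open>i deg L + 1\<close> at a chosen point, more than its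
  degree allows. Independence over a finite field persists over the algebraic closure by
  Artin's lemma, because the sections are fixed by Frobenius.
\<close>

section \<open>Finite subfields and their Frobenius automorphisms\<close>

text \<open>Orders of vanishing and degrees are geometric, that is, defined over the algebraic
  closure, while the two bases live over different finite fields: \<open>e\<close> over
  \<open>k\<close> and \<open>b\<close> over \<open>k'\<close>. Hence two Frobenius maps occur. The
  one of \<open>k\<close> twists the divisor and the matrix. To bound the length of a basis over a
  field \<open>K\<close>, Artin's lemma is applied with the Frobenius of \<open>K\<close> itself: it
  fixes all sections defined over \<open>K\<close>, and coefficients fixed by it lie in
  \<open>K\<close> again. Sections over \<open>k'\<close> need not be fixed by the Frobenius of
  \<open>k\<close>.

  Germs are plain functions, compared near a point; their ring is not known in advance to be a
  domain, let alone a valuation ring. Smoothness supplies a uniformiser, each power of the maximal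
  ideal is generated by a power of it, and everything about orders is read off the
  cofactors.\<close>

text \<open>By finiteness, closure under negation and inversion is automatic.\<close>

definition finite_subfield :: "'a::field set \<Rightarrow> bool" where
  "finite_subfield K \<longleftrightarrow>
     finite K \<and> 0 \<in> K \<and> 1 \<in> K \<and> (\<forall>a\<in>K. \<forall>b\<in>K. a + b \<in> K \<and> a * b \<in> K)"

text \<open>Multiplication by a nonzero \<open>a\<close> permutes \<open>K - {0}\<close>, so the
  product of the nonzero elements is unchanged although it acquires the factor
  \<open>a ^ card (K - {0})\<close>.\<close>

lemma finite_subfield_power_card:
  assumes K: "finite_subfield K" and a: "a \<in> K"
  shows "a ^ card K = a"
proof (cases "a = 0")
  case True
  then show ?thesis
    using K unfolding finite_subfield_def by (auto simp: card_gt_0_iff)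
next
  case False
  let ?U = "K - {0}"
  have fin: "finite ?U" using K by (simp add: finite_subfield_def)
  have inj: "inj_on ((*) a) ?U" using False by (auto simp: inj_on_def)
  have "(*) a ` ?U \<subseteq> ?U" using K a False by (auto simp: finite_subfield_def)
  then have img: "(*) a ` ?U = ?U" by (rule card_subset_eq[OF fin]) (rule card_image[OF inj])
  have "(\<Prod>x\<in>?U. x) = (\<Prod>x\<in>?U. a * x)"
    using prod.reindex[OF inj, of "\<lambda>x. x"] img by (simp add: o_def)
  also have "\<dots> = a ^ card ?U * (\<Prod>x\<in>?U. x)" by (simp add: prod.distrib)
  finally have "a ^ card ?U = 1" using fin by (simp add: prod_zero_iff)
  moreover have "card K = Suc (card ?U)"
    using K unfolding finite_subfield_def by (metis card_Suc_Diff1)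
  ultimately show ?thesis by simp
qed

lemma finite_subfield_card_gt_1:
  assumes "finite_subfield (K :: 'a::field set)"
  shows "1 < card K"
proof -
  have "{0, 1} \<subseteq> K" "finite K" using assms by (auto simp: finite_subfield_def)
  then have "card {0, 1 :: 'a} \<le> card K" by (intro card_mono)
  then show ?thesis by simp
qed

text \<open>The polynomial \<open>X^q - X\<close> has at most \<open>q\<close> roots, and
  \<open>K\<close> already provides \<open>q\<close> of them. This brings Frobenius-fixed
  coefficients back into \<open>K\<close>.\<close>

lemma finite_subfield_eq_fixed:
  assumes K: "finite_subfield (K :: 'a::field set)"
  shows "K = {a. a ^ card K = a}"
proof -
  let ?q = "card K"
  let ?p = "monom 1 ?q - monom 1 1 :: 'a poly"
  have q: "1 < ?q" by (rule finite_subfield_card_gt_1[OF K])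
  have dp: "degree ?p = ?q"
    using q by (subst diff_conv_add_uminus, subst degree_add_eq_left) (auto simp: degree_monom_eq)
  then have p0: "?p \<noteq> 0" using q by (metis degree_0 not_less_zero)
  have eq: "{a. a ^ ?q = a} = {a. poly ?p a = 0}" by (auto simp: poly_monom)
  have "K \<subseteq> {a :: 'a. a ^ ?q = a}" using finite_subfield_power_card[OF K] by auto
  moreover have "card {a :: 'a. a ^ ?q = a} \<le> ?q"
    using card_poly_roots_bound[OF p0] unfolding eq dp .
  moreover have "finite {a :: 'a. a ^ ?q = a}"
    unfolding eq using p0 by (rule poly_roots_finite)
  ultimately show ?thesis by (meson card_seteq)
qed

text \<open>No characteristic is needed: \<open>(X + 1)\<^sup>q - X\<^sup>q - 1\<close> has degree less than \<open>q\<close> and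
  vanishes on the \<open>q\<close> elements of \<open>K\<close>.\<close>

lemma finite_subfield_power_card_add:
  fixes a b :: "'a::field"
  assumes K: "finite_subfield (K :: 'a set)"
  shows "(a + b) ^ card K = a ^ card K + b ^ card K"
proof -
  let ?q = "card K"
  let ?p = "[:1, 1:] ^ ?q - monom 1 ?q - 1 :: 'a poly"
  have q: "1 < ?q" by (rule finite_subfield_card_gt_1[OF K])
  have deg: "degree ([:1, 1:] ^ ?q :: 'a poly) = ?q" by (simp add: degree_power_eq)
  have "degree ([:1, 1:] ^ ?q - monom 1 ?q :: 'a poly) < ?q"
  proof (rule degree_lessI)
    show "[:1, 1:] ^ ?q - monom 1 ?q \<noteq> (0 :: 'a poly) \<or> 0 < ?q" using q by simp
    show "\<forall>k\<ge>?q. coeff ([:1, 1:] ^ ?q - monom 1 ?q :: 'a poly) k = 0"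
    proof (intro allI impI)
      fix k assume k: "?q \<le> k"
      show "coeff ([:1, 1:] ^ ?q - monom 1 ?q :: 'a poly) k = 0"
      proof (cases "k = ?q")
        case True
        have "lead_coeff ([:1, 1:] ^ ?q :: 'a poly) = 1" by (simp add: lead_coeff_power)
        then show ?thesis using True deg by simp
      next
        case False
        then show ?thesis using k deg by (simp add: coeff_eq_0)
      qed
    qed
  qed
  then have dp: "degree ?p < ?q" by (rule degree_diff_less) (use q in simp)
  have "poly ?p x = 0" if x: "x \<in> K" for x
  proof -
    have "1 + x \<in> K" using K x by (auto simp: finite_subfield_def)
    then have "(1 + x) ^ ?q = 1 + x" "x ^ ?q = x"
      using x finite_subfield_power_card[OF K] by auto
    then show ?thesis by (simp add: poly_monom poly_power)
  qed
  then have sub: "K \<subseteq> {x. poly ?p x = 0}" by auto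
  have "?p = 0"
  proof (rule ccontr)
    assume ne: "?p \<noteq> 0"
    have "?q \<le> card {x. poly ?p x = 0}" by (rule card_mono[OF poly_roots_finite[OF ne] sub])
    also have "\<dots> \<le> degree ?p" by (rule card_poly_roots_bound[OF ne])
    finally show False using dp by simp
  qed
  then have 1: "(1 + x) ^ ?q = x ^ ?q + 1" for x :: 'a
  proof -
    have "poly ?p x = 0" using \<open>?p = 0\<close> by simp
    then show ?thesis by (simp add: poly_monom poly_power algebra_simps)
  qed
  show ?thesis
  proof (cases "b = 0")
    case True
    then show ?thesis using q by (simp add: zero_power)
  next
    case False
    \<comment> \<open>The identity in one variable is homogenised by scaling with
      \<open>b\<close>.\<close>
    have "(1 + a / b) * b = a + b" using False by (simp add: distrib_right)
    then have "(a + b) ^ ?q = ((1 + a / b) * b) ^ ?q" by (simp only:)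
    also have "\<dots> = ((a / b) ^ ?q + 1) * b ^ ?q" by (simp only: power_mult_distrib 1)
    also have "\<dots> = a ^ ?q + b ^ ?q" using False by (simp add: field_simps)
    finally show ?thesis .
  qed
qed

text \<open>The automorphism is kept abstract so that each transport result applies both to the
  Frobenius and to its inverse; the inverse then yields surjectivity on spaces of sections.\<close>

locale field_automorphism =
  fixes \<tau> :: "'a::field \<Rightarrow> 'a"
  assumes bij: "bij \<tau>"
    and add: "\<tau> (a + b) = \<tau> a + \<tau> b"
    and mult: "\<tau> (a * b) = \<tau> a * \<tau> b"
begin

lemma inj: "\<tau> a = \<tau> b \<longleftrightarrow> a = b"
  using bij by (auto simp: bij_def inj_def)

lemma zero [simp]: "\<tau> 0 = 0"
proof -
  have "\<tau> 0 + 0 = \<tau> 0 + \<tau> 0" using add[of 0 0] by (simp only: add_0_right)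
  then show ?thesis by (simp only: add_left_cancel)
qed

lemma eq_zero [simp]: "\<tau> a = 0 \<longleftrightarrow> a = 0"
  using inj[of a 0] by simp

lemma one [simp]: "\<tau> 1 = 1"
  using mult[of 1 1] eq_zero[of 1] by simp

lemma divide: "\<tau> (a / b) = \<tau> a / \<tau> b"
proof (cases "b = 0")
  case False
  have "\<tau> (a / b) * \<tau> b = \<tau> a" using False by (simp add: mult[symmetric])
  then show ?thesis using False by (simp add: field_simps)
qed simp

lemma sum: "\<tau> (sum f A) = (\<Sum>x\<in>A. \<tau> (f x))"
  by (induction A rule: infinite_finite_induct) (auto simp: add)

lemma prod: "\<tau> (prod f A) = (\<Prod>x\<in>A. \<tau> (f x))"
  by (induction A rule: infinite_finite_induct) (auto simp: mult)

lemma power: "\<tau> (a ^ m) = \<tau> a ^ m"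
  by (induction m) (auto simp: mult)

lemma inv_inv [simp]: "inv_into UNIV \<tau> (\<tau> a) = a" "\<tau> (inv_into UNIV \<tau> a) = a"
  using bij by (simp_all add: bij_is_inj bij_is_surj surj_f_inv_f)

lemma field_automorphism_inv: "field_automorphism (inv_into UNIV \<tau>)"
proof
  show "bij (inv_into UNIV \<tau>)" using bij by (rule bij_imp_bij_inv)
  show "inv_into UNIV \<tau> (a + b) = inv_into UNIV \<tau> a + inv_into UNIV \<tau> b" for a b
    by (metis add inv_inv)
  show "inv_into UNIV \<tau> (a * b) = inv_into UNIV \<tau> a * inv_into UNIV \<tau> b" for a b
    by (metis mult inv_inv)
qed

end

text \<open>Additivity gives injectivity, since equal powers force
  \<open>(a - b) ^ card K = 0\<close>; roots in the algebraically closed field give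
  surjectivity.\<close>

lemma field_automorphism_frobenius:
  fixes K :: "'a::alg_closed_field set"
  assumes K: "finite_subfield K"
  shows "field_automorphism (\<lambda>a :: 'a. a ^ card K)"
proof -
  let ?q = "card K"
  have q: "1 < ?q" by (rule finite_subfield_card_gt_1[OF K])
  have add: "(a + b) ^ ?q = a ^ ?q + b ^ ?q" for a b :: 'a
    by (rule finite_subfield_power_card_add[OF K])
  have "inj (\<lambda>a :: 'a. a ^ ?q)"
  proof (rule injI)
    fix a b :: 'a assume eq: "a ^ ?q = b ^ ?q"
    have "(a - b) ^ ?q + b ^ ?q = a ^ ?q" using add[of "a - b" b] by simp
    then show "a = b" using eq q by simp
  qed
  moreover have "surj (\<lambda>a :: 'a. a ^ ?q)"
  proof (rule surj_def[THEN iffD2, rule_format])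
    fix y :: 'a
    show "\<exists>x. y = x ^ ?q" using nth_root_exists[of ?q y] q by auto
  qed
  ultimately have "bij (\<lambda>a :: 'a. a ^ ?q)" by (simp add: bij_def)
  then show ?thesis using add unfolding field_automorphism_def by (simp add: power_mult_distrib)
qed

lemma finite_subfield_if_subfield:
  assumes "subfield K (ring_of_type_algebra :: 'a::field ring)" and "finite K"
  shows "finite_subfield K"
  using subringE[OF subfieldE(1)[OF assms(1)]] assms(2)
  by (simp add: finite_subfield_def ring_of_type_algebra_def)

lemma finite_subfield_range_to_ac:
  "finite_subfield (range (to_ac :: 'k::{field,finite} \<Rightarrow> 'k alg_closure))"
  unfolding finite_subfield_def
  by (auto simp flip: to_ac_0 to_ac_1 to_ac_add to_ac_mult)

section \<open>Forms and the Zariski topology\<close>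

lemma finite_exponents: "finite (exponents n d)"
proof (rule finite_subset)
  show "exponents n d \<subseteq> {m. \<forall>i. (i \<in> {..n} \<longrightarrow> m i \<in> {..d}) \<and> (i \<notin> {..n} \<longrightarrow> m i = 0)}"
    by (auto simp: exponents_def intro: member_le_sum)
  show "finite {m. \<forall>i. (i \<in> {..n} \<longrightarrow> m i \<in> {..d}) \<and> (i \<notin> {..n} \<longrightarrow> m i = (0::nat))}"
    by (rule finite_set_of_finite_funs) auto
qed

lemma forms_mono: "K \<subseteq> K' \<Longrightarrow> forms K n d \<subseteq> forms K' n d"
  by (auto simp: forms_def)

lemma forms_const:
  assumes "a \<in> K"
  shows "(\<lambda>x. a) \<in> forms K n 0"
proof -
  have "m = (\<lambda>i. 0)" if "m \<in> exponents n 0" for m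
  proof
    fix i
    show "m i = 0" using that by (cases "i \<le> n") (auto simp: exponents_def)
  qed
  moreover have "(\<lambda>i. 0) \<in> exponents n 0" by (simp add: exponents_def)
  ultimately have "exponents n 0 = {\<lambda>i. 0}" by blast
  then show ?thesis using assms by (auto simp: forms_def intro!: exI[of _ "\<lambda>m. a"])
qed

lemma forms_add:
  assumes "F \<in> forms UNIV n d" "G \<in> forms UNIV n d"
  shows "(\<lambda>x. F x + G x) \<in> forms UNIV n d"
proof -
  obtain c where "F = (\<lambda>x. \<Sum>m\<in>exponents n d. c m * (\<Prod>i\<le>n. x i ^ m i))"
    using assms(1) by (auto simp: forms_def)
  moreover obtain c' where "G = (\<lambda>x. \<Sum>m\<in>exponents n d. c' m * (\<Prod>i\<le>n. x i ^ m i))"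
    using assms(2) by (auto simp: forms_def)
  ultimately show ?thesis
    by (auto simp: forms_def sum.distrib distrib_right intro!: exI[of _ "\<lambda>m. c m + c' m"])
qed

text \<open>The coefficients of the product are convolutions: pairs of exponents are grouped by
  their sum.\<close>

lemma forms_mult:
  assumes "F \<in> forms UNIV n d" "G \<in> forms UNIV n d'"
  shows "(\<lambda>x. F x * G x) \<in> forms UNIV n (d + d')"
proof -
  obtain c where F: "F = (\<lambda>x. \<Sum>m\<in>exponents n d. c m * (\<Prod>i\<le>n. x i ^ m i))"
    using assms(1) by (auto simp: forms_def)
  obtain c' where G: "G = (\<lambda>x. \<Sum>m\<in>exponents n d'. c' m * (\<Prod>i\<le>n. x i ^ m i))"
    using assms(2) by (auto simp: forms_def)
  let ?S = "exponents n d \<times> exponents n d'"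
  let ?h = "\<lambda>(m, m') i. m i + m' i :: nat"
  have maps: "?h ` ?S \<subseteq> exponents n (d + d')"
    by (auto simp: exponents_def sum.distrib)
  have "F x * G x =
      (\<Sum>m\<in>exponents n (d + d'). (\<Sum>p\<in>{p \<in> ?S. ?h p = m}. c (fst p) * c' (snd p)) *
        (\<Prod>i\<le>n. x i ^ m i))" for x
  proof -
    have "F x * G x = (\<Sum>p\<in>?S. c (fst p) * c' (snd p) * (\<Prod>i\<le>n. x i ^ ?h p i))"
      unfolding F G sum_product sum.cartesian_product
      by (rule sum.cong) (auto simp: power_add prod.distrib mult_ac)
    also have "\<dots> = (\<Sum>m\<in>exponents n (d + d'). \<Sum>p\<in>{p \<in> ?S. ?h p = m}.
        c (fst p) * c' (snd p) * (\<Prod>i\<le>n. x i ^ ?h p i))"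
      by (rule sum.group[symmetric]) (simp_all only: finite_cartesian_product finite_exponents maps)
    also have "\<dots> = (\<Sum>m\<in>exponents n (d + d'). \<Sum>p\<in>{p \<in> ?S. ?h p = m}.
        c (fst p) * c' (snd p) * (\<Prod>i\<le>n. x i ^ m i))"
      by (intro sum.cong) auto
    finally show ?thesis by (simp add: sum_distrib_right)
  qed
  then show ?thesis
    by (auto simp: forms_def fun_eq_iff
        intro!: exI[of _ "\<lambda>m. \<Sum>p\<in>{p \<in> ?S. ?h p = m}. c (fst p) * c' (snd p)"])
qed

lemma forms_homogeneous:
  assumes "F \<in> forms K n d"
  shows "F (\<lambda>i. a * x i) = a ^ d * F x"
proof -
  obtain c where F: "F = (\<lambda>x. \<Sum>m\<in>exponents n d. c m * (\<Prod>i\<le>n. x i ^ m i))"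
    using assms by (auto simp: forms_def)
  have "c m * (\<Prod>i\<le>n. (a * x i) ^ m i) = a ^ d * (c m * (\<Prod>i\<le>n. x i ^ m i))"
    if "m \<in> exponents n d" for m
  proof -
    have "(\<Prod>i\<le>n. a ^ m i) = a ^ d"
      using that by (simp add: exponents_def flip: power_sum)
    then show ?thesis by (simp add: power_mult_distrib prod.distrib mult_ac)
  qed
  then show ?thesis unfolding F sum_distrib_left by (rule sum.cong[OF refl])
qed

lemma proj_space_nonempty: "P \<in> proj_space n \<Longrightarrow> P \<noteq> {}"
  by (auto simp: proj_space_def intro: exI[of _ 1])

lemma forms_zero_on_point:
  assumes "F \<in> forms K n d" "P \<in> proj_space n" "x \<in> P" "y \<in> P" "F x \<noteq> 0"
  shows "F y \<noteq> 0"
  using assms by (auto simp: proj_space_def forms_homogeneous)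

lemma basic_open_mult:
  fixes F G :: "(nat \<Rightarrow> 'a::field) \<Rightarrow> 'a"
  shows "basic_open n F \<inter> basic_open n G = basic_open n (\<lambda>x. F x * G x)"
  by (auto simp: basic_open_def)

lemma openin_basic_open: "F \<in> forms K n d \<Longrightarrow> openin (zariski K n) (basic_open n F)"
  unfolding zariski_def by (rule topology_generated_by_Basis) auto

lemma topspace_zariski_subset: "topspace (zariski K n) \<subseteq> proj_space n"
  by (auto simp: zariski_def basic_open_def)

lemma topspace_zariski:
  assumes "1 \<in> K"
  shows "topspace (zariski K n) = proj_space n"
proof (rule antisym[OF topspace_zariski_subset])
  have "basic_open n (\<lambda>x. 1) \<subseteq> topspace (zariski K n)"
    by (intro openin_subset openin_basic_open[OF forms_const[OF assms]])
  then show "proj_space n \<subseteq> topspace (zariski K n)"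
    by (simp add: basic_open_def)
qed

text \<open>The basic open sets are only a subbasis by definition. Products of forms close them
  under intersection, so they form a basis.\<close>

lemma openin_zariski_basis:
  assumes "openin (zariski UNIV n) U" "P \<in> U"
  shows "\<exists>d. \<exists>F\<in>forms UNIV n d. P \<in> basic_open n F \<and> basic_open n F \<subseteq> U"
proof -
  have "generate_topology_on {basic_open n F | F d. F \<in> forms UNIV n d} U"
    using assms(1) unfolding zariski_def by (rule openin_topology_generated_by)
  then show ?thesis using assms(2)
  proof (induction rule: generate_topology_on.induct)
    case (Int A B)
    obtain d F where F: "F \<in> forms UNIV n d" "P \<in> basic_open n F" "basic_open n F \<subseteq> A"
      using Int by blast
    obtain d' G where G: "G \<in> forms UNIV n d'" "P \<in> basic_open n G" "basic_open n G \<subseteq> B"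
      using Int by blast
    show ?case using F G basic_open_mult[of n F G] forms_mult[OF F(1) G(1)] by blast
  qed blast+
qed

lemma openin_zariski_mono:
  assumes "K \<subseteq> K'" "openin (zariski K n) U"
  shows "openin (zariski K' n) U"
proof -
  have "generate_topology_on {basic_open n F | F d. F \<in> forms K n d} U"
    using assms(2) unfolding zariski_def by (rule openin_topology_generated_by)
  then show ?thesis
    by (rule generate_topology_on_coarsest[rotated 2])
      (use forms_mono[OF assms(1)] in \<open>auto intro: openin_basic_open\<close>)
qed

text \<open>The constant form \<open>1\<close> makes both topologies live on all of projective
  space, so the complement of \<open>C\<close> is the same for both fields.\<close>

lemma closedin_zariski_mono:
  assumes K: "K \<subseteq> K'" "1 \<in> K" and C: "closedin (zariski K n) C"
  shows "closedin (zariski K' n) C"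
proof -
  have T: "topspace (zariski K n) = proj_space n" "topspace (zariski K' n) = proj_space n"
    using K by (intro topspace_zariski; blast)+
  show ?thesis
    using C openin_zariski_mono[OF K(1), of n "proj_space n - C"] by (simp add: closedin_def T)
qed

section \<open>Regular functions\<close>

lemma regular_onI:
  assumes "\<And>P. P \<in> U \<Longrightarrow> \<exists>d F G. F \<in> forms K n d \<and> G \<in> forms K n d \<and>
    (\<forall>x\<in>P. G x \<noteq> 0) \<and> (\<forall>Q\<in>U. \<forall>x\<in>Q. G x \<noteq> 0 \<longrightarrow> f Q = F x / G x)"
  shows "regular_on K n U f"
  unfolding regular_on_def Bex_def using assms by simp

lemma regular_onE:
  assumes "regular_on K n U f" and "P \<in> U"
  obtains d F G where "F \<in> forms K n d" "G \<in> forms K n d" "\<forall>x\<in>P. G x \<noteq> 0"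
    "\<forall>Q\<in>U. \<forall>x\<in>Q. G x \<noteq> 0 \<longrightarrow> f Q = F x / G x"
  using assms unfolding regular_on_def by blast

lemma regular_on_subset:
  assumes "regular_on K n U f" "W \<subseteq> U"
  shows "regular_on K n W f"
proof (rule regular_onI)
  fix P assume "P \<in> W"
  then obtain d F G where 1: "F \<in> forms K n d" "G \<in> forms K n d" "\<forall>x\<in>P. G x \<noteq> 0"
    "\<forall>Q\<in>U. \<forall>x\<in>Q. G x \<noteq> 0 \<longrightarrow> f Q = F x / G x"
    using assms by (auto elim: regular_onE)
  then show "\<exists>d F G. F \<in> forms K n d \<and> G \<in> forms K n d \<and> (\<forall>x\<in>P. G x \<noteq> 0) \<and>
      (\<forall>Q\<in>W. \<forall>x\<in>Q. G x \<noteq> 0 \<longrightarrow> f Q = F x / G x)"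
    using assms(2) by (intro exI[of _ d] exI[of _ F] exI[of _ G]) auto
qed

lemma regular_on_mono:
  assumes "K \<subseteq> K'" "regular_on K n U f"
  shows "regular_on K' n U f"
proof (rule regular_onI)
  fix P assume "P \<in> U"
  with assms(2) obtain d F G where 1: "F \<in> forms K n d" "G \<in> forms K n d" "\<forall>x\<in>P. G x \<noteq> 0"
    "\<forall>Q\<in>U. \<forall>x\<in>Q. G x \<noteq> 0 \<longrightarrow> f Q = F x / G x"
    by (rule regular_onE)
  then show "\<exists>d F G. F \<in> forms K' n d \<and> G \<in> forms K' n d \<and> (\<forall>x\<in>P. G x \<noteq> 0) \<and>
      (\<forall>Q\<in>U. \<forall>x\<in>Q. G x \<noteq> 0 \<longrightarrow> f Q = F x / G x)"
    using forms_mono[OF assms(1)] by blast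
qed

lemma regular_on_const: "regular_on UNIV n U (\<lambda>Q. a)"
  by (rule regular_onI, rule exI[of _ 0], rule exI[of _ "\<lambda>x. a"], rule exI[of _ "\<lambda>x. 1"])
    (simp add: forms_const)

lemma regular_on_cong: "(\<And>Q. Q \<in> U \<Longrightarrow> f Q = h Q) \<Longrightarrow> regular_on K n U f \<longleftrightarrow> regular_on K n U h"
  unfolding regular_on_def by simp

lemma regular_on_mult:
  assumes f: "regular_on UNIV n U f" and h: "regular_on UNIV n U h"
  shows "regular_on UNIV n U (\<lambda>Q. f Q * h Q)"
proof (rule regular_onI)
  fix P assume P: "P \<in> U"
  obtain d F G where 1: "F \<in> forms UNIV n d" "G \<in> forms UNIV n d" "\<forall>x\<in>P. G x \<noteq> 0"
    "\<forall>Q\<in>U. \<forall>x\<in>Q. G x \<noteq> 0 \<longrightarrow> f Q = F x / G x"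
    using f P by (rule regular_onE)
  obtain d' F' G' where 2: "F' \<in> forms UNIV n d'" "G' \<in> forms UNIV n d'" "\<forall>x\<in>P. G' x \<noteq> 0"
    "\<forall>Q\<in>U. \<forall>x\<in>Q. G' x \<noteq> 0 \<longrightarrow> h Q = F' x / G' x"
    using h P by (rule regular_onE)
  show "\<exists>d F G. F \<in> forms UNIV n d \<and> G \<in> forms UNIV n d \<and> (\<forall>x\<in>P. G x \<noteq> 0) \<and>
      (\<forall>Q\<in>U. \<forall>x\<in>Q. G x \<noteq> 0 \<longrightarrow> f Q * h Q = F x / G x)"
    using forms_mult[OF 1(1) 2(1)] forms_mult[OF 1(2) 2(2)] 1(3,4) 2(3,4)
    by (intro exI[of _ "d + d'"] exI[of _ "\<lambda>x. F x * F' x"] exI[of _ "\<lambda>x. G x * G' x"]) simp_all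
qed

lemma regular_on_add:
  assumes f: "regular_on UNIV n U f" and h: "regular_on UNIV n U h"
  shows "regular_on UNIV n U (\<lambda>Q. f Q + h Q)"
proof (rule regular_onI)
  fix P assume P: "P \<in> U"
  obtain d F G where 1: "F \<in> forms UNIV n d" "G \<in> forms UNIV n d" "\<forall>x\<in>P. G x \<noteq> 0"
    "\<forall>Q\<in>U. \<forall>x\<in>Q. G x \<noteq> 0 \<longrightarrow> f Q = F x / G x"
    using f P by (rule regular_onE)
  obtain d' F' G' where 2: "F' \<in> forms UNIV n d'" "G' \<in> forms UNIV n d'" "\<forall>x\<in>P. G' x \<noteq> 0"
    "\<forall>Q\<in>U. \<forall>x\<in>Q. G' x \<noteq> 0 \<longrightarrow> h Q = F' x / G' x"
    using h P by (rule regular_onE)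
  have "(\<lambda>x. F x * G' x + G x * F' x) \<in> forms UNIV n (d + d')"
    by (intro forms_add forms_mult 1 2)
  then show "\<exists>d F G. F \<in> forms UNIV n d \<and> G \<in> forms UNIV n d \<and> (\<forall>x\<in>P. G x \<noteq> 0) \<and>
      (\<forall>Q\<in>U. \<forall>x\<in>Q. G x \<noteq> 0 \<longrightarrow> f Q + h Q = F x / G x)"
    using forms_mult[OF 1(2) 2(2)] 1(3,4) 2(3,4)
    by (intro exI[of _ "d + d'"] exI[of _ "\<lambda>x. F x * G' x + G x * F' x"]
        exI[of _ "\<lambda>x. G x * G' x"]) (simp_all add: add_frac_eq mult.commute)
qed

lemma regular_on_power: "regular_on UNIV n U f \<Longrightarrow> regular_on UNIV n U (\<lambda>Q. f Q ^ m)"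
  by (induction m) (auto intro: regular_on_const regular_on_mult)

lemma regular_on_sum:
  "(\<And>j. j \<in> A \<Longrightarrow> regular_on UNIV n U (f j)) \<Longrightarrow> regular_on UNIV n U (\<lambda>Q. \<Sum>j\<in>A. f j Q)"
  by (induction A rule: infinite_finite_induct) (auto intro: regular_on_const regular_on_add)

text \<open>The description \<open>F / G\<close> of \<open>f\<close> is available only where
  \<open>G\<close> does not vanish. So \<open>1 / f\<close> is written as
  \<open>G * G / (F * G)\<close> instead of \<open>G / F\<close>: a nonzero denominator then
  guarantees that \<open>G\<close> is nonzero too.\<close>

lemma regular_on_inverse:
  assumes f: "regular_on UNIV n U f" and U: "U \<subseteq> proj_space n" and nz: "\<And>Q. Q \<in> U \<Longrightarrow> f Q \<noteq> 0"
  shows "regular_on UNIV n U (\<lambda>Q. 1 / f Q)"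
proof (rule regular_onI)
  fix P assume P: "P \<in> U"
  obtain d F G where 1: "F \<in> forms UNIV n d" "G \<in> forms UNIV n d" "\<forall>x\<in>P. G x \<noteq> 0"
    "\<forall>Q\<in>U. \<forall>x\<in>Q. G x \<noteq> 0 \<longrightarrow> f Q = F x / G x"
    using f P by (rule regular_onE)
  have "\<forall>x\<in>P. F x * G x \<noteq> 0"
    using 1(3,4) nz[OF P] P by fastforce
  then show "\<exists>d F G. F \<in> forms UNIV n d \<and> G \<in> forms UNIV n d \<and> (\<forall>x\<in>P. G x \<noteq> 0) \<and>
      (\<forall>Q\<in>U. \<forall>x\<in>Q. G x \<noteq> 0 \<longrightarrow> 1 / f Q = F x / G x)"
    using forms_mult[OF 1(2) 1(2)] forms_mult[OF 1(1) 1(2)] 1(4)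
    by (intro exI[of _ "d + d"] exI[of _ "\<lambda>x. G x * G x"] exI[of _ "\<lambda>x. F x * G x"]) simp_all
qed

lemma openin_nonzero:
  assumes U: "openin (zariski UNIV n) U" and CU: "W = C \<inter> U" and f: "regular_on UNIV n W f"
  shows "\<exists>V. openin (zariski UNIV n) V \<and> {Q \<in> W. f Q \<noteq> 0} = C \<inter> V"
proof -
  \<comment> \<open>Taking every basic open set on which \<open>f\<close> has no zero avoids
    choosing a local fraction at each point.\<close>
  let ?B = "{basic_open n G \<inter> U | G d. G \<in> forms UNIV n d \<and> (\<forall>Q\<in>C \<inter> (basic_open n G \<inter> U). f Q \<noteq> 0)}"
  have Usub: "U \<subseteq> proj_space n"
    using openin_subset[OF U] topspace_zariski_subset by blast
  have "openin (zariski UNIV n) (\<Union>?B)"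
    by (rule openin_Union) (auto intro: openin_Int U openin_basic_open)
  moreover have "{Q \<in> W. f Q \<noteq> 0} = C \<inter> \<Union>?B"
  proof (intro equalityI subsetI)
    fix P assume "P \<in> {Q \<in> W. f Q \<noteq> 0}"
    then have P: "P \<in> W" "f P \<noteq> 0" by auto
    obtain d F G where 1: "F \<in> forms UNIV n d" "G \<in> forms UNIV n d" "\<forall>x\<in>P. G x \<noteq> 0"
      "\<forall>Q\<in>W. \<forall>x\<in>Q. G x \<noteq> 0 \<longrightarrow> f Q = F x / G x"
      using f P(1) by (rule regular_onE)
    \<comment> \<open>Where this form does not vanish, the fraction \<open>F / G\<close> both
      describes \<open>f\<close> and is nonzero.\<close>
    let ?FG = "\<lambda>x. F x * G x"
    have "\<forall>x\<in>P. ?FG x \<noteq> 0" using 1(3,4) P by fastforce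
    then have "P \<in> basic_open n ?FG" using P CU Usub by (auto simp: basic_open_def)
    moreover have "f Q \<noteq> 0" if Q: "Q \<in> C \<inter> (basic_open n ?FG \<inter> U)" for Q
    proof -
      obtain x where x: "x \<in> Q" using Q proj_space_nonempty[of Q n] by (auto simp: basic_open_def)
      then have "F x * G x \<noteq> 0" using Q by (auto simp: basic_open_def)
      then show ?thesis using 1(4) Q CU x by auto
    qed
    ultimately show "P \<in> C \<inter> \<Union>?B" using P CU forms_mult[OF 1(1) 1(2)] by blast
  qed (auto simp: CU)
  ultimately show ?thesis by blast
qed

lemma openin_geom_nonzero:
  assumes "openin (geom_top n C) W" and "regular_on UNIV n W f"
  shows "openin (geom_top n C) {Q \<in> W. f Q \<noteq> 0}"
proof -
  obtain U where "openin (zariski UNIV n) U" "W = U \<inter> C"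
    using assms(1) by (auto simp: openin_subtopology)
  then show ?thesis
    using openin_nonzero[of n U W C f] assms(2) by (auto simp: openin_subtopology Int_commute)
qed

lemma openin_geom_basis:
  assumes "openin (geom_top n C) W" "P \<in> W"
  shows "\<exists>d. \<exists>F\<in>forms UNIV n d. P \<in> C \<inter> basic_open n F \<and> C \<inter> basic_open n F \<subseteq> W"
proof -
  obtain U where U: "openin (zariski UNIV n) U" "W = U \<inter> C"
    using assms(1) by (auto simp: openin_subtopology)
  then show ?thesis using openin_zariski_basis[of n U P] assms(2) by blast
qed

lemma openin_geom_basic_open: "F \<in> forms UNIV n d \<Longrightarrow> openin (geom_top n C) (C \<inter> basic_open n F)"
  unfolding openin_subtopology by (blast intro: openin_basic_open)

section \<open>Local rings\<close>

declare max_ideal_power.simps(2) [simp del]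

locale projective_subset =
  fixes n :: nat and C :: "'a::field point set"
  assumes subset_proj_space: "C \<subseteq> proj_space n"
begin

text \<open>With the neighbourhood filter, finitely many local identities combine by
  \<open>eventually_elim\<close>, and no neighbourhoods have to be intersected by hand.\<close>

abbreviation near :: "'a point \<Rightarrow> 'a point filter" where
  "near P \<equiv> nhdsin (geom_top n C) P"

lemma topspace_geom: "topspace (geom_top n C) = C"
  using subset_proj_space by (auto simp: topspace_zariski)

lemma openin_geom_whole: "openin (geom_top n C) C"
  using openin_topspace[of "geom_top n C"] unfolding topspace_geom .

lemma eventually_near:
  "P \<in> C \<Longrightarrow> eventually R (near P) \<longleftrightarrow>
     (\<exists>W. openin (geom_top n C) W \<and> P \<in> W \<and> (\<forall>Q\<in>W. R Q))"
  unfolding eventually_nhdsin topspace_geom by simp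

lemma eventually_near_open: "openin (geom_top n C) W \<Longrightarrow> P \<in> W \<Longrightarrow> \<forall>\<^sub>F Q in near P. Q \<in> W"
  unfolding eventually_nhdsin by blast

lemma eventually_near_self: "eventually R (near P) \<Longrightarrow> P \<in> C \<Longrightarrow> R P"
  by (auto simp: eventually_near)

lemma eq_near_iff: "P \<in> C \<Longrightarrow> eq_near n C P f h \<longleftrightarrow> (\<forall>\<^sub>F Q in near P. f Q = h Q)"
  by (simp add: eventually_near eq_near_def)

lemma regular_on_imp_regular_at:
  "openin (geom_top n C) W \<Longrightarrow> P \<in> W \<Longrightarrow> regular_on UNIV n W f \<Longrightarrow> regular_at n C P f"
  unfolding regular_at_def by blast

lemma regular_at_cong:
  assumes "regular_at n C P f" "\<forall>\<^sub>F Q in near P. f Q = h Q" "P \<in> C"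
  shows "regular_at n C P h"
proof -
  obtain W where W: "openin (geom_top n C) W" "P \<in> W" "regular_on UNIV n W f"
    using assms(1) unfolding regular_at_def by blast
  obtain V where V: "openin (geom_top n C) V" "P \<in> V" "\<forall>Q\<in>V. f Q = h Q"
    using assms(2,3) eventually_near by blast
  have "regular_on UNIV n (W \<inter> V) f" by (rule regular_on_subset[OF W(3)]) simp
  then have "regular_on UNIV n (W \<inter> V) h" using V(3) by (subst (asm) regular_on_cong[of _ f h]) auto
  then show ?thesis using W V by (intro regular_on_imp_regular_at[of "W \<inter> V"]) auto
qed

lemma regular_at_const: "P \<in> C \<Longrightarrow> regular_at n C P (\<lambda>Q. a)"
  by (rule regular_on_imp_regular_at[OF openin_geom_whole _ regular_on_const])

lemma regular_at_mult:
  assumes "regular_at n C P f" "regular_at n C P h"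
  shows "regular_at n C P (\<lambda>Q. f Q * h Q)"
proof -
  obtain W where W: "openin (geom_top n C) W" "P \<in> W" "regular_on UNIV n W f"
    using assms(1) unfolding regular_at_def by blast
  obtain V where V: "openin (geom_top n C) V" "P \<in> V" "regular_on UNIV n V h"
    using assms(2) unfolding regular_at_def by blast
  have "regular_on UNIV n (W \<inter> V) (\<lambda>Q. f Q * h Q)"
    by (rule regular_on_mult; rule regular_on_subset[OF W(3)] regular_on_subset[OF V(3)]; simp)
  then show ?thesis using W V by (intro regular_on_imp_regular_at[of "W \<inter> V"]) auto
qed

lemma regular_at_add:
  assumes "regular_at n C P f" "regular_at n C P h"
  shows "regular_at n C P (\<lambda>Q. f Q + h Q)"
proof -
  obtain W where W: "openin (geom_top n C) W" "P \<in> W" "regular_on UNIV n W f"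
    using assms(1) unfolding regular_at_def by blast
  obtain V where V: "openin (geom_top n C) V" "P \<in> V" "regular_on UNIV n V h"
    using assms(2) unfolding regular_at_def by blast
  have "regular_on UNIV n (W \<inter> V) (\<lambda>Q. f Q + h Q)"
    by (rule regular_on_add; rule regular_on_subset[OF W(3)] regular_on_subset[OF V(3)]; simp)
  then show ?thesis using W V by (intro regular_on_imp_regular_at[of "W \<inter> V"]) auto
qed

lemma regular_at_diff:
  assumes "regular_at n C P f" "regular_at n C P h" "P \<in> C"
  shows "regular_at n C P (\<lambda>Q. f Q - h Q)"
  using regular_at_add[OF assms(1) regular_at_mult[OF regular_at_const[OF assms(3), of "-1"] assms(2)]]
  by simp

lemma regular_at_sum:
  assumes "P \<in> C" "\<And>j. j \<in> A \<Longrightarrow> regular_at n C P (f j)"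
  shows "regular_at n C P (\<lambda>Q. \<Sum>j\<in>A. f j Q)"
  using assms
  by (induction A rule: infinite_finite_induct) (auto intro: regular_at_const regular_at_add)

lemma regular_at_power:
  "P \<in> C \<Longrightarrow> regular_at n C P f \<Longrightarrow> regular_at n C P (\<lambda>Q. f Q ^ m)"
  by (induction m) (auto intro: regular_at_const regular_at_mult)

lemma eventually_nonzero:
  assumes "regular_at n C P f" "f P \<noteq> 0"
  shows "\<forall>\<^sub>F Q in near P. f Q \<noteq> 0"
proof -
  obtain W where W: "openin (geom_top n C) W" "P \<in> W" "regular_on UNIV n W f"
    using assms(1) unfolding regular_at_def by blast
  have "\<forall>\<^sub>F Q in near P. Q \<in> {Q \<in> W. f Q \<noteq> 0}"
    by (rule eventually_near_open[OF openin_geom_nonzero[OF W(1,3)]]) (use W(2) assms(2) in simp)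
  then show ?thesis by eventually_elim simp
qed

text \<open>Used in contrapositive form: a germ that has an order cannot vanish near
  \<open>P\<close>. The empty sum witnesses membership in every positive power.\<close>

lemma max_ideal_power_zero:
  assumes "P \<in> C" "\<forall>\<^sub>F Q in near P. f Q = 0"
  shows "f \<in> max_ideal_power n C P m"
proof -
  have "\<forall>\<^sub>F Q in near P. 0 = f Q" using assms(2) by eventually_elim simp
  then have reg: "regular_at n C P f"
    using assms(1) by (rule regular_at_cong[OF regular_at_const[OF assms(1)]])
  have "eq_near n C P f (\<lambda>Q. \<Sum>j<(0::nat). 0)"
    using assms by (simp add: eq_near_iff)
  then show ?thesis
    using reg by (cases m) (auto simp: max_ideal_power.simps(2) intro!: exI[where x = "0::nat"])
qed

lemma max_ideal_power_regular: "f \<in> max_ideal_power n C P m \<Longrightarrow> regular_at n C P f"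
  by (cases m) (auto simp: max_ideal_power.simps(2))

end

text \<open>A uniformiser \<open>t\<close> is fixed. The rules \<open>max_ideal_powerI\<close> and
  \<open>max_ideal_powerE\<close> then replace the recursive definition by divisibility by
  \<open>t ^ m\<close>.\<close>

locale smooth_point = projective_subset +
  fixes P t
  assumes P: "P \<in> C" and t_regular: "regular_at n C P t" and t_zero: "t P = 0"
    and t_generates: "\<And>f. regular_at n C P f \<Longrightarrow> f P = 0 \<Longrightarrow>
      \<exists>h. regular_at n C P h \<and> eq_near n C P f (\<lambda>Q. t Q * h Q)"
begin

lemma t_dividesE:
  assumes "regular_at n C P f" "f P = 0"
  obtains h where "regular_at n C P h" "\<forall>\<^sub>F Q in near P. f Q = t Q * h Q"
  using t_generates[OF assms] by (auto simp: eq_near_iff[OF P])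

lemma max_ideal_powerI:
  assumes "regular_at n C P u" "\<forall>\<^sub>F Q in near P. f Q = t Q ^ m * u Q"
  shows "f \<in> max_ideal_power n C P m"
  using assms
proof (induction m arbitrary: f u)
  case 0
  have "\<forall>\<^sub>F Q in near P. u Q = f Q" using 0(2) by eventually_elim simp
  then show ?case using regular_at_cong[OF 0(1)] P by simp
next
  case (Suc m)
  let ?g = "\<lambda>Q. t Q ^ m * u Q"
  have g: "?g \<in> max_ideal_power n C P m" by (rule Suc.IH[OF Suc.prems(1)]) simp
  have "regular_at n C P (\<lambda>Q. t Q ^ Suc m * u Q)"
    by (intro regular_at_mult regular_at_power P t_regular Suc.prems(1))
  moreover have "\<forall>\<^sub>F Q in near P. t Q ^ Suc m * u Q = f Q"
    using Suc.prems(2) by eventually_elim simp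
  ultimately have "regular_at n C P f" using P by (rule regular_at_cong)
  moreover have "eq_near n C P f (\<lambda>Q. \<Sum>j<(1::nat). ?g Q * t Q)"
    unfolding eq_near_iff[OF P] using Suc.prems(2) by eventually_elim (simp add: mult_ac)
  ultimately show ?case
    unfolding max_ideal_power.simps(2) mem_Collect_eq using g t_regular t_zero
    by (intro conjI exI[where x = "1::nat"] exI[where x = "\<lambda>_. ?g"] exI[where x = "\<lambda>_. t"]) auto
qed

text \<open>In each product \<open>g j * h j\<close> the first factor contributes
  \<open>t ^ m\<close> and the second, vanishing at \<open>P\<close>, one more \<open>t\<close>; the
  cofactors add up.\<close>

lemma max_ideal_powerE:
  assumes "f \<in> max_ideal_power n C P m"
  obtains u where "regular_at n C P u" "\<forall>\<^sub>F Q in near P. f Q = t Q ^ m * u Q"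
  using assms
proof (induction m arbitrary: f thesis)
  case 0
  show ?case by (rule 0(1)[of f]) (use 0(2) in simp_all)
next
  case (Suc m)
  obtain N :: nat and g h where gh: "\<forall>j<N. g j \<in> max_ideal_power n C P m \<and> regular_at n C P (h j) \<and> h j P = 0"
    and f: "eq_near n C P f (\<lambda>Q. \<Sum>j<N. g j Q * h j Q)"
    using Suc.prems(2) by (auto simp: max_ideal_power.simps(2))
  have "\<exists>u. regular_at n C P u \<and> (\<forall>\<^sub>F Q in near P. g j Q * h j Q = t Q ^ Suc m * u Q)"
    if j: "j < N" for j
  proof -
    obtain u where u: "regular_at n C P u" "\<forall>\<^sub>F Q in near P. g j Q = t Q ^ m * u Q"
      using Suc.IH[of "g j"] gh j by blast
    obtain v where v: "regular_at n C P v" "\<forall>\<^sub>F Q in near P. h j Q = t Q * v Q"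
      using gh j t_dividesE[of "h j"] by blast
    have "\<forall>\<^sub>F Q in near P. g j Q * h j Q = t Q ^ Suc m * (u Q * v Q)"
      using u(2) v(2) by eventually_elim (simp add: mult_ac)
    then show ?thesis using regular_at_mult[OF u(1) v(1)] by blast
  qed
  then have "\<forall>j\<in>{..<N}. \<exists>u. regular_at n C P u \<and>
      (\<forall>\<^sub>F Q in near P. g j Q * h j Q = t Q ^ Suc m * u Q)"
    by simp
  from bchoice[OF this] obtain u where u: "\<And>j. j < N \<Longrightarrow> regular_at n C P (u j)"
    "\<And>j. j < N \<Longrightarrow> \<forall>\<^sub>F Q in near P. g j Q * h j Q = t Q ^ Suc m * u j Q"
    by auto
  have "\<forall>\<^sub>F Q in near P. \<forall>j\<in>{..<N}. g j Q * h j Q = t Q ^ Suc m * u j Q"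
    using u(2) by (simp add: eventually_ball_finite_distrib)
  moreover have "\<forall>\<^sub>F Q in near P. f Q = (\<Sum>j<N. g j Q * h j Q)"
    using f by (simp add: eq_near_iff[OF P])
  ultimately have "\<forall>\<^sub>F Q in near P. f Q = t Q ^ Suc m * (\<Sum>j<N. u j Q)"
    by eventually_elim (simp add: sum_distrib_left)
  moreover have "regular_at n C P (\<lambda>Q. \<Sum>j<N. u j Q)"
    using u(1) by (intro regular_at_sum P) simp
  ultimately show ?case using Suc.prems(1) by blast
qed

lemma max_ideal_power_antimono:
  assumes "f \<in> max_ideal_power n C P m" "k \<le> m"
  shows "f \<in> max_ideal_power n C P k"
proof -
  obtain u where u: "regular_at n C P u" "\<forall>\<^sub>F Q in near P. f Q = t Q ^ m * u Q"
    using assms(1) by (rule max_ideal_powerE)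
  have "\<forall>\<^sub>F Q in near P. f Q = t Q ^ k * (t Q ^ (m - k) * u Q)"
    using u(2) by eventually_elim (use assms(2) in \<open>simp flip: power_add mult.assoc\<close>)
  then show ?thesis
    by (rule max_ideal_powerI[rotated]) (intro regular_at_mult regular_at_power P t_regular u(1))
qed

lemma max_ideal_power_mult:
  assumes "f \<in> max_ideal_power n C P a" "h \<in> max_ideal_power n C P b"
  shows "(\<lambda>Q. f Q * h Q) \<in> max_ideal_power n C P (a + b)"
proof -
  obtain u where u: "regular_at n C P u" "\<forall>\<^sub>F Q in near P. f Q = t Q ^ a * u Q"
    using assms(1) by (rule max_ideal_powerE)
  obtain v where v: "regular_at n C P v" "\<forall>\<^sub>F Q in near P. h Q = t Q ^ b * v Q"
    using assms(2) by (rule max_ideal_powerE)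
  have "\<forall>\<^sub>F Q in near P. f Q * h Q = t Q ^ (a + b) * (u Q * v Q)"
    using u(2) v(2) by eventually_elim (simp add: power_add mult_ac)
  then show ?thesis by (rule max_ideal_powerI[OF regular_at_mult[OF u(1) v(1)]])
qed

lemma max_ideal_power_cong:
  assumes "f \<in> max_ideal_power n C P m" "\<forall>\<^sub>F Q in near P. f Q = h Q"
  shows "h \<in> max_ideal_power n C P m"
proof -
  obtain u where u: "regular_at n C P u" "\<forall>\<^sub>F Q in near P. f Q = t Q ^ m * u Q"
    using assms(1) by (rule max_ideal_powerE)
  have "\<forall>\<^sub>F Q in near P. h Q = t Q ^ m * u Q"
    using u(2) assms(2) by eventually_elim simp
  then show ?thesis by (rule max_ideal_powerI[OF u(1)])
qed

lemma germ_order_mem: "germ_order n C P f a \<Longrightarrow> f \<in> max_ideal_power n C P a"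
  unfolding germ_order_def by blast

text \<open>A cofactor vanishing at \<open>P\<close> would be divisible by \<open>t\<close> and
  would push \<open>f\<close> into the next power.\<close>

lemma germ_orderE:
  assumes "germ_order n C P f a"
  obtains u where "regular_at n C P u" "u P \<noteq> 0" "\<forall>\<^sub>F Q in near P. f Q = t Q ^ a * u Q"
proof -
  obtain u where u: "regular_at n C P u" "\<forall>\<^sub>F Q in near P. f Q = t Q ^ a * u Q"
    using germ_order_mem[OF assms] by (rule max_ideal_powerE)
  moreover have "u P \<noteq> 0"
  proof
    assume "u P = 0"
    then obtain v where v: "regular_at n C P v" "\<forall>\<^sub>F Q in near P. u Q = t Q * v Q"
      using u(1) t_dividesE by blast
    have "\<forall>\<^sub>F Q in near P. f Q = t Q ^ Suc a * v Q"
      using u(2) v(2) by eventually_elim simp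
    then have "f \<in> max_ideal_power n C P (Suc a)" by (rule max_ideal_powerI[OF v(1)])
    then show False using assms unfolding germ_order_def by blast
  qed
  ultimately show thesis using that by blast
qed

lemma germ_order_not_zero_near:
  assumes "germ_order n C P f a"
  shows "\<not> (\<forall>\<^sub>F Q in near P. f Q = 0)"
  using assms max_ideal_power_zero[OF P] unfolding germ_order_def by blast

text \<open>Cancelling \<open>t ^ (a + b)\<close> is not possible in a ring not known to be a
  domain. If the product had higher order, then \<open>t ^ (a + b)\<close> times
  \<open>u * v - t * w\<close> would vanish near \<open>P\<close>; the second factor is nonzero
  there, so \<open>t\<close> itself would vanish near \<open>P\<close>, and with it whichever of
  \<open>f\<close> and \<open>h\<close> has positive order.\<close>

lemma germ_order_mult:
  assumes f: "germ_order n C P f a" and h: "germ_order n C P h b"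
  shows "germ_order n C P (\<lambda>Q. f Q * h Q) (a + b)"
  unfolding germ_order_def
proof
  show "(\<lambda>Q. f Q * h Q) \<in> max_ideal_power n C P (a + b)"
    by (rule max_ideal_power_mult[OF germ_order_mem[OF f] germ_order_mem[OF h]])
  show "(\<lambda>Q. f Q * h Q) \<notin> max_ideal_power n C P (Suc (a + b))"
  proof
    assume "(\<lambda>Q. f Q * h Q) \<in> max_ideal_power n C P (Suc (a + b))"
    then obtain w where w: "regular_at n C P w"
      "\<forall>\<^sub>F Q in near P. f Q * h Q = t Q ^ Suc (a + b) * w Q"
      by (rule max_ideal_powerE)
    obtain u where u: "regular_at n C P u" "u P \<noteq> 0" "\<forall>\<^sub>F Q in near P. f Q = t Q ^ a * u Q"
      using f by (rule germ_orderE)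
    obtain v where v: "regular_at n C P v" "v P \<noteq> 0" "\<forall>\<^sub>F Q in near P. h Q = t Q ^ b * v Q"
      using h by (rule germ_orderE)
    have "regular_at n C P (\<lambda>Q. u Q * v Q - t Q * w Q)"
      by (intro regular_at_diff regular_at_mult u v w t_regular P)
    then have "\<forall>\<^sub>F Q in near P. u Q * v Q - t Q * w Q \<noteq> 0"
      by (rule eventually_nonzero) (simp add: t_zero u v)
    then have t0: "\<forall>\<^sub>F Q in near P. t Q ^ (a + b) = 0"
      using u(3) v(3) w(2)
    proof eventually_elim
      case (elim Q)
      have "t Q ^ (a + b) * (u Q * v Q - t Q * w Q) = 0"
        using elim(2-4) by (simp add: power_add algebra_simps)
      then show ?case using elim(1) by simp
    qed
    \<comment> \<open>For \<open>a + b = 0\<close> the power would be the constant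
      \<open>1\<close>.\<close>
    then have "a + b > 0" using eventually_near_self[OF t0 P] by (cases "a + b") auto
    then have "(\<forall>\<^sub>F Q in near P. f Q = 0) \<or> (\<forall>\<^sub>F Q in near P. h Q = 0)"
    proof (cases "a = 0")
      case False
      have "\<forall>\<^sub>F Q in near P. f Q = 0"
        using t0 u(3) by eventually_elim (use False in simp)
      then show ?thesis ..
    next
      case True
      have "\<forall>\<^sub>F Q in near P. h Q = 0"
        using t0 v(3) by eventually_elim (use True \<open>a + b > 0\<close> in simp)
      then show ?thesis ..
    qed
    then show False using germ_order_not_zero_near f h by blast
  qed
qed

lemma germ_order_power:
  assumes "germ_order n C P f a"
  shows "germ_order n C P (\<lambda>Q. f Q ^ m) (m * a)"
proof (induction m)
  case 0
  have "(\<lambda>Q. 1) \<notin> max_ideal_power n C P (Suc 0)"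
  proof
    assume "(\<lambda>Q. 1) \<in> max_ideal_power n C P (Suc 0)"
    then obtain u where "regular_at n C P u" and *: "\<forall>\<^sub>F Q in near P. 1 = t Q ^ Suc 0 * u Q"
      by (rule max_ideal_powerE)
    show False using eventually_near_self[OF * P] t_zero by simp
  qed
  then show ?case using regular_at_const[OF P, of 1] by (simp add: germ_order_def)
next
  case (Suc m)
  show ?case using germ_order_mult[OF assms Suc] by simp
qed

text \<open>For \<open>s\<close> only a lower bound on the vanishing is given, not an order, so
  additivity of orders is replaced by this inequality.\<close>

lemma germ_order_le:
  assumes "s \<in> max_ideal_power n C P N" "germ_order n C P h b" "germ_order n C P g a"
    and "\<forall>\<^sub>F Q in near P. s Q * h Q = g Q"
  shows "N + b \<le> a"
proof (rule ccontr)
  assume "\<not> N + b \<le> a"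
  have "(\<lambda>Q. s Q * h Q) \<in> max_ideal_power n C P (N + b)"
    by (rule max_ideal_power_mult[OF assms(1) germ_order_mem[OF assms(2)]])
  then have "g \<in> max_ideal_power n C P (N + b)" using assms(4) by (rule max_ideal_power_cong)
  then have "g \<in> max_ideal_power n C P (Suc a)"
    by (rule max_ideal_power_antimono) (use \<open>\<not> N + b \<le> a\<close> in simp)
  then show False using assms(3) by (simp add: germ_order_def)
qed

text \<open>Each further order of vanishing is one linear condition.\<close>

lemma exists_vanishing_combination:
  assumes "finite I" "N < card I" "\<And>j. j \<in> I \<Longrightarrow> regular_at n C P (s j)"
  shows "\<exists>c. (\<exists>j\<in>I. c j \<noteq> 0) \<and> (\<lambda>Q. \<Sum>j\<in>I. c j * s j Q) \<in> max_ideal_power n C P N"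
  using assms
proof (induction N arbitrary: I s)
  case 0
  then have "I \<noteq> {}" by auto
  moreover have "regular_at n C P (\<lambda>Q. \<Sum>j\<in>I. 1 * s j Q)"
    using 0 by (intro regular_at_sum regular_at_mult regular_at_const P) auto
  ultimately show ?case by (intro exI[of _ "\<lambda>_. 1"]) auto
next
  case (Suc N)
  \<comment> \<open>A pivot \<open>r\<close> is chosen with nonzero value at \<open>P\<close> if
    there is one. If all functions vanish at \<open>P\<close>, any index and any multipliers will
    do. Subtracting multiples of \<open>s r\<close> makes the others vanish at \<open>P\<close>, at
    the cost of one function.\<close>
  have "\<exists>r\<in>I. \<exists>l. \<forall>j\<in>I. j \<noteq> r \<longrightarrow> s j P = l j * s r P"
  proof (cases "\<exists>r\<in>I. s r P \<noteq> 0")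
    case True
    then obtain r where "r \<in> I" "s r P \<noteq> 0" by blast
    then show ?thesis by (intro bexI[of _ r] exI[of _ "\<lambda>j. s j P / s r P"]) auto
  next
    case False
    moreover have "I \<noteq> {}" using Suc.prems by auto
    ultimately show ?thesis by fastforce
  qed
  then obtain r l where r: "r \<in> I" and l: "\<And>j. j \<in> I - {r} \<Longrightarrow> s j P = l j * s r P" by blast
  let ?I = "I - {r}"
  let ?s = "\<lambda>j Q. s j Q - l j * s r Q"
  have "\<exists>u. regular_at n C P u \<and> (\<forall>\<^sub>F Q in near P. ?s j Q = t Q * u Q)" if j: "j \<in> ?I" for j
  proof -
    have "regular_at n C P (?s j)"
      using j r Suc.prems(3) by (intro regular_at_diff regular_at_mult regular_at_const P) auto
    moreover have "?s j P = 0" using l[OF j] by simp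
    ultimately show ?thesis using t_dividesE by blast
  qed
  then have "\<forall>j\<in>?I. \<exists>u. regular_at n C P u \<and> (\<forall>\<^sub>F Q in near P. ?s j Q = t Q * u Q)" by blast
  from bchoice[OF this] obtain u where u: "\<And>j. j \<in> ?I \<Longrightarrow> regular_at n C P (u j)"
    "\<And>j. j \<in> ?I \<Longrightarrow> \<forall>\<^sub>F Q in near P. ?s j Q = t Q * u j Q"
    by blast
  have fin: "finite ?I" and card: "N < card ?I" using Suc.prems(1,2) r by auto
  have "\<exists>c. (\<exists>j\<in>?I. c j \<noteq> 0) \<and>
      (\<lambda>Q. \<Sum>j\<in>?I. c j * u j Q) \<in> max_ideal_power n C P N"
    using fin card u(1) by (rule Suc.IH)
  then obtain c where c: "\<exists>j\<in>?I. c j \<noteq> 0"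
    "(\<lambda>Q. \<Sum>j\<in>?I. c j * u j Q) \<in> max_ideal_power n C P N"
    by (elim exE conjE)
  \<comment> \<open>The coefficient at the pivot is the one obtained by expanding the combination of
    the differences \<open>s j - l j * s r\<close>.\<close>
  define c' where "c' = c(r := - (\<Sum>j\<in>?I. c j * l j))"
  have comb: "(\<Sum>j\<in>I. c' j * s j Q) = (\<Sum>j\<in>?I. c j * ?s j Q)" for Q
  proof -
    have "(\<Sum>j\<in>?I. c' j * s j Q) = (\<Sum>j\<in>?I. c j * s j Q)"
      by (rule sum.cong) (auto simp: c'_def)
    moreover have "c' r * s r Q = - (\<Sum>j\<in>?I. c j * (l j * s r Q))"
      by (simp add: c'_def sum_distrib_right mult.assoc)
    ultimately show ?thesis
      unfolding sum.remove[OF Suc.prems(1) r] by (simp add: sum_subtractf right_diff_distrib)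
  qed
  have "t \<in> max_ideal_power n C P 1"
    by (rule max_ideal_powerI[OF regular_at_const[OF P, of 1]]) simp
  then have "(\<lambda>Q. t Q * (\<Sum>j\<in>?I. c j * u j Q)) \<in> max_ideal_power n C P (1 + N)"
    using c(2) by (rule max_ideal_power_mult)
  moreover have "\<forall>\<^sub>F Q in near P. t Q * (\<Sum>j\<in>?I. c j * u j Q) = (\<Sum>j\<in>I. c' j * s j Q)"
  proof -
    have "\<forall>\<^sub>F Q in near P. \<forall>j\<in>?I. ?s j Q = t Q * u j Q"
      using u(2) fin by (simp add: eventually_ball_finite_distrib)
    then show ?thesis
      by eventually_elim (simp add: comb sum_distrib_left mult.left_commute)
  qed
  ultimately have "(\<lambda>Q. \<Sum>j\<in>I. c' j * s j Q) \<in> max_ideal_power n C P (1 + N)"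
    by (rule max_ideal_power_cong)
  moreover have "\<exists>j\<in>I. c' j \<noteq> 0" using c(1) by (auto simp: c'_def)
  ultimately show ?case by (intro exI[of _ c']) (simp only: plus_1_eq_Suc simp_thms)
qed

end

section \<open>Degrees of sections\<close>

text \<open>The forms \<open>F1\<close> and \<open>F2\<close> act as switches. Multiplying numerator
  and denominator of a local fraction by \<open>F1\<close> confines the condition on the denominator
  to the first piece; on the second piece \<open>0 * F2 / F2\<close> is such a fraction.\<close>

lemma regular_on_glue_zero:
  assumes F1: "F1 \<in> forms UNIV n d1" and F2: "F2 \<in> forms UNIV n d2"
    and W: "W \<subseteq> basic_open n F1 \<union> basic_open n F2"
    and disj: "W \<inter> basic_open n F1 \<inter> basic_open n F2 = {}"
    and f: "regular_on UNIV n (W \<inter> basic_open n F1) f"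
  shows "regular_on UNIV n W (\<lambda>Q. if Q \<in> basic_open n F1 then f Q else 0)"
proof (rule regular_onI)
  have proj: "Q \<in> proj_space n" if "Q \<in> W" for Q using that W by (auto simp: basic_open_def)
  have in1: "Q \<in> basic_open n F1" if "Q \<in> W" "x \<in> Q" "F1 x \<noteq> 0" for Q x
    using forms_zero_on_point[OF F1 proj[OF that(1)] that(2) _ that(3)] proj[OF that(1)]
    by (simp add: basic_open_def)
  have in2: "Q \<in> basic_open n F2" if "Q \<in> W" "x \<in> Q" "F2 x \<noteq> 0" for Q x
    using forms_zero_on_point[OF F2 proj[OF that(1)] that(2) _ that(3)] proj[OF that(1)]
    by (simp add: basic_open_def)
  fix P assume P: "P \<in> W"
  let ?f = "\<lambda>Q. if Q \<in> basic_open n F1 then f Q else 0"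
  show "\<exists>d F G. F \<in> forms UNIV n d \<and> G \<in> forms UNIV n d \<and> (\<forall>x\<in>P. G x \<noteq> 0) \<and>
      (\<forall>Q\<in>W. \<forall>x\<in>Q. G x \<noteq> 0 \<longrightarrow> ?f Q = F x / G x)"
  proof (cases "P \<in> basic_open n F1")
    case True
    then have "P \<in> W \<inter> basic_open n F1" using P by simp
    with f obtain d F G where 1: "F \<in> forms UNIV n d" "G \<in> forms UNIV n d" "\<forall>x\<in>P. G x \<noteq> 0"
      "\<forall>Q\<in>W \<inter> basic_open n F1. \<forall>x\<in>Q. G x \<noteq> 0 \<longrightarrow> f Q = F x / G x"
      by (rule regular_onE)
    have "\<forall>x\<in>P. G x * F1 x \<noteq> 0" using 1(3) True by (simp add: basic_open_def)
    moreover have "\<forall>Q\<in>W. \<forall>x\<in>Q. G x * F1 x \<noteq> 0 \<longrightarrow> ?f Q = (F x * F1 x) / (G x * F1 x)"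
      using 1(4) in1 by auto
    ultimately show ?thesis using forms_mult[OF 1(1) F1] forms_mult[OF 1(2) F1] by blast
  next
    case False
    then have "P \<in> basic_open n F2" using P W by blast
    then have "\<forall>x\<in>P. F2 x \<noteq> 0" by (simp add: basic_open_def)
    moreover have "\<forall>Q\<in>W. \<forall>x\<in>Q. F2 x \<noteq> 0 \<longrightarrow> ?f Q = 0 * F2 x / F2 x"
      using in2 disj by fastforce
    moreover have "(\<lambda>x. 0 * F2 x) \<in> forms UNIV n d2" using forms_mult[OF forms_const[OF UNIV_I, of 0 n] F2] by simp
    ultimately show ?thesis using F2 by blast
  qed
qed

section \<open>Sections, irreducibility and degrees\<close>

lemma tensor_power_simps [simp]:
  "num_charts (tensor_power L i) = num_charts L"
  "chart (tensor_power L i) = chart L"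
  "transition (tensor_power L i) a b P = transition L a b P ^ i"
  by (simp_all add: tensor_power_def)

lemma global_sectionsD:
  assumes "s \<in> global_sections K n L"
  shows "a < num_charts L \<Longrightarrow> regular_on K n (chart L a) (s a)"
    and "a < num_charts L \<Longrightarrow> b < num_charts L \<Longrightarrow> P \<in> chart L a \<Longrightarrow> P \<in> chart L b \<Longrightarrow>
      s a P = transition L a b P * s b P"
    and "\<not> (a < num_charts L \<and> P \<in> chart L a) \<Longrightarrow> s a P = 0"
  using assms unfolding global_sections_def by blast+

lemma global_sections_linear_combination:
  assumes "\<And>j. j \<in> I \<Longrightarrow> s j \<in> global_sections UNIV n L"
  shows "(\<lambda>a P. \<Sum>j\<in>I. c j * s j a P) \<in> global_sections UNIV n L"
  unfolding global_sections_def mem_Collect_eq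
proof (intro conjI allI impI ballI)
  fix a assume "a < num_charts L"
  then show "regular_on UNIV n (chart L a) (\<lambda>P. \<Sum>j\<in>I. c j * s j a P)"
    by (intro regular_on_sum regular_on_mult regular_on_const global_sectionsD(1)[OF assms])
next
  fix a b P assume *: "a < num_charts L" "b < num_charts L" "P \<in> chart L a \<inter> chart L b"
  have "c j * s j a P = transition L a b P * (c j * s j b P)" if "j \<in> I" for j
    using global_sectionsD(2)[OF assms[OF that], of a b P] * by simp
  then show "(\<Sum>j\<in>I. c j * s j a P) = transition L a b P * (\<Sum>j\<in>I. c j * s j b P)"
    unfolding sum_distrib_left by (rule sum.cong[OF refl])
next
  fix a P assume "\<not> (a < num_charts L \<and> P \<in> chart L a)"
  then show "(\<Sum>j\<in>I. c j * s j a P) = 0"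
    using global_sectionsD(3)[OF assms] by (intro sum.neutral) simp
qed

locale curve_with_line_bundle = projective_subset +
  fixes L and d :: int
  assumes line_bundle: "is_line_bundle UNIV n C L"
    and degree: "has_degree n C L d"
    and smooth: "\<And>P. P \<in> C \<Longrightarrow> smooth_curve_at n C P"
begin

lemma openin_chart: "a < num_charts L \<Longrightarrow> openin (geom_top n C) (chart L a)"
  using line_bundle unfolding is_line_bundle_def by blast

lemma chart_subset: "a < num_charts L \<Longrightarrow> chart L a \<subseteq> C"
  using openin_subset[OF openin_chart] by (simp add: topspace_geom)

lemma in_chartE:
  assumes "P \<in> C"
  obtains a where "a < num_charts L" "P \<in> chart L a"
  using assms line_bundle unfolding is_line_bundle_def by blast

lemma transition_regular:
  "a < num_charts L \<Longrightarrow> b < num_charts L \<Longrightarrow>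
     regular_on UNIV n (chart L a \<inter> chart L b) (transition L a b)"
  using line_bundle unfolding is_line_bundle_def by blast

lemma transition_nonzero:
  "a < num_charts L \<Longrightarrow> b < num_charts L \<Longrightarrow> P \<in> chart L a \<Longrightarrow> P \<in> chart L b \<Longrightarrow>
     transition L a b P \<noteq> 0"
  using line_bundle unfolding is_line_bundle_def by blast

lemma transition_cocycle:
  "a < num_charts L \<Longrightarrow> b < num_charts L \<Longrightarrow> c < num_charts L \<Longrightarrow>
     P \<in> chart L a \<Longrightarrow> P \<in> chart L b \<Longrightarrow> P \<in> chart L c \<Longrightarrow>
     transition L a c P = transition L a b P * transition L b c P"
  using line_bundle unfolding is_line_bundle_def by blast

text \<open>Irreducibility comes from the degree alone: on two disjoint open sets, the section that
  trivialises the bundle on the first and vanishes on the second would have infinite order at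
  the points of the second.\<close>

lemma nonempty_opens_meet:
  assumes V1: "openin (geom_top n C) V1" "P1 \<in> V1" and V2: "openin (geom_top n C) V2" "P2 \<in> V2"
  shows "V1 \<inter> V2 \<noteq> {}"
proof
  assume disj: "V1 \<inter> V2 = {}"
  have "P1 \<in> C" "P2 \<in> C"
    using openin_subset[OF V1(1)] openin_subset[OF V2(1)] V1 V2 by (auto simp: topspace_geom)
  obtain a where a: "a < num_charts L" "P1 \<in> chart L a" using \<open>P1 \<in> C\<close> by (rule in_chartE)
  \<comment> \<open>Both sets are shrunk to basic open ones because the extension by zero needs the
    defining forms; the first is also put inside a chart, where the bundle is trivial.\<close>
  have "openin (geom_top n C) (V1 \<inter> chart L a)" using V1(1) openin_chart[OF a(1)] by (rule openin_Int)
  then obtain d1 F1 where F1: "F1 \<in> forms UNIV n d1" "P1 \<in> C \<inter> basic_open n F1"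
    "C \<inter> basic_open n F1 \<subseteq> V1 \<inter> chart L a"
    using openin_geom_basis[of n C "V1 \<inter> chart L a" P1] V1(2) a(2) by blast
  obtain d2 F2 where F2: "F2 \<in> forms UNIV n d2" "P2 \<in> C \<inter> basic_open n F2"
    "C \<inter> basic_open n F2 \<subseteq> V2"
    using openin_geom_basis[OF V2] by blast
  have meet: "C \<inter> basic_open n F1 \<inter> basic_open n F2 = {}" using F1(3) F2(3) disj by blast
  define V where "V = C \<inter> basic_open n F1 \<union> C \<inter> basic_open n F2"
  define s where "s = (\<lambda>b Q. if Q \<in> basic_open n F1 then transition L b a Q else 0)"
  have "nonzero_rational_section n C L V s"
    unfolding nonzero_rational_section_def
  proof (intro conjI allI impI ballI)
    show "openin (geom_top n C) V"
      unfolding V_def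
      by (rule openin_Un[OF openin_geom_basic_open[OF F1(1)] openin_geom_basic_open[OF F2(1)]])
  next
    fix b assume b: "b < num_charts L"
    have "V \<inter> chart L b \<inter> basic_open n F1 \<subseteq> chart L b \<inter> chart L a"
      using F1(3) meet by (auto simp: V_def)
    then have "regular_on UNIV n (V \<inter> chart L b \<inter> basic_open n F1) (transition L b a)"
      by (rule regular_on_subset[OF transition_regular[OF b a(1)]])
    then show "regular_on UNIV n (V \<inter> chart L b) (s b)"
      unfolding s_def using meet
      by (intro regular_on_glue_zero[OF F1(1) F2(1)]) (auto simp: V_def)
  next
    fix b c P assume *: "b < num_charts L" "c < num_charts L" "P \<in> V \<inter> chart L b \<inter> chart L c"
    show "s b P = transition L b c P * s c P"
    proof (cases "P \<in> basic_open n F1")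
      case True
      then have "P \<in> chart L a" using * F1(3) by (auto simp: V_def)
      then have "transition L b a P = transition L b c P * transition L c a P"
        using * by (intro transition_cocycle a(1)) auto
      then show ?thesis using True by (simp only: s_def if_True)
    qed (simp add: s_def)
  next
    show "\<exists>a<num_charts L. \<exists>P\<in>V \<inter> chart L a. s a P \<noteq> 0"
      using a F1(2) transition_nonzero[OF a(1) a(1) a(2) a(2)]
      by (intro exI[of _ a] conjI bexI[of _ P1]) (auto simp: s_def V_def)
  qed
  then obtain E where "section_divisor n C L V s E"
    using degree unfolding has_degree_def by blast
  moreover obtain b where "b < num_charts L" "P2 \<in> chart L b" using \<open>P2 \<in> C\<close> by (rule in_chartE)
  ultimately have "rational_order n C V P2 (s b) (E P2)" by (simp add: section_divisor_def)
  then obtain g h W m where W: "openin (geom_top n C) W" "P2 \<in> W" and g: "germ_order n C P2 g m"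
    and eq: "\<forall>Q\<in>V \<inter> W. s b Q * h Q = g Q"
    unfolding rational_order_def by blast
  have "\<forall>\<^sub>F Q in near P2. Q \<in> C \<inter> basic_open n F2"
    by (rule eventually_near_open[OF openin_geom_basic_open[OF F2(1)] F2(2)])
  moreover have "\<forall>\<^sub>F Q in near P2. Q \<in> W" by (rule eventually_near_open[OF W])
  \<comment> \<open>Near \<open>P2\<close> the section is zero, hence so is the numerator
    \<open>g\<close> of its local description, although \<open>g\<close> has the finite order
    \<open>m\<close>.\<close>
  ultimately have "\<forall>\<^sub>F Q in near P2. g Q = 0"
  proof eventually_elim
    case (elim Q)
    then have "Q \<in> V \<inter> W" "Q \<notin> basic_open n F1" using meet by (auto simp: V_def)
    then show ?case using eq by (force simp: s_def)
  qed
  then show False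
    using g max_ideal_power_zero[OF \<open>P2 \<in> C\<close>] unfolding germ_order_def by blast
qed

text \<open>An identity theorem: the points near \<open>P\<close> where \<open>f\<close> and
  \<open>h\<close> differ form an open set that misses \<open>V\<close>, so by irreducibility there
  are none. It carries identities of rational sections to points outside their domain
  \<open>V\<close>.\<close>

lemma eventually_eq_if_eq_on_open:
  assumes V: "openin (geom_top n C) V" "R \<in> V" and P: "P \<in> C"
    and f: "regular_at n C P f" and h: "regular_at n C P h"
    and eq: "\<forall>\<^sub>F Q in near P. Q \<in> V \<longrightarrow> f Q = h Q"
  shows "\<forall>\<^sub>F Q in near P. f Q = h Q"
proof -
  obtain W where W: "openin (geom_top n C) W" "P \<in> W" "regular_on UNIV n W (\<lambda>Q. f Q - h Q)"
    using regular_at_diff[OF f h P] unfolding regular_at_def by blast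
  obtain U where U: "openin (geom_top n C) U" "P \<in> U" "\<forall>Q\<in>U. Q \<in> V \<longrightarrow> f Q = h Q"
    using eq eventually_near[OF P] by blast
  have "openin (geom_top n C) {Q \<in> W. f Q - h Q \<noteq> 0}" by (rule openin_geom_nonzero[OF W(1,3)])
  then have N: "openin (geom_top n C) ({Q \<in> W. f Q - h Q \<noteq> 0} \<inter> U)" using U(1) by (rule openin_Int)
  have "{Q \<in> W. f Q - h Q \<noteq> 0} \<inter> U = {}"
  proof (rule ccontr)
    assume "{Q \<in> W. f Q - h Q \<noteq> 0} \<inter> U \<noteq> {}"
    then have "{Q \<in> W. f Q - h Q \<noteq> 0} \<inter> U \<inter> V \<noteq> {}"
      using nonempty_opens_meet[OF N _ V] by blast
    then show False using U(3) by auto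
  qed
  then have "f Q = h Q" if "Q \<in> W \<inter> U" for Q using that by auto
  moreover have "\<forall>\<^sub>F Q in near P. Q \<in> W \<inter> U"
    using openin_Int[OF W(1) U(1)] by (rule eventually_near_open) (use W(2) U(2) in simp)
  ultimately show ?thesis by (rule eventually_mono[rotated])
qed

lemma smooth_pointE:
  assumes "P \<in> C"
  obtains t where "smooth_point n C P t"
proof -
  obtain t where "regular_at n C P t" "t P = 0"
    "\<forall>f. regular_at n C P f \<and> f P = 0 \<longrightarrow>
       (\<exists>h. regular_at n C P h \<and> eq_near n C P f (\<lambda>Q. t Q * h Q))"
    using smooth[OF assms] unfolding smooth_curve_at_def by blast
  then have "smooth_point n C P t"
    using assms by unfold_locales auto
  then show thesis by (rule that)
qed

text \<open>A section \<open>s\<close> of \<open>L\<^sup>i\<close> is \<open>\<sigma> s\<^sub>0\<^bsup>i-1\<^esup>\<close> for rational sections \<open>\<sigma>\<close>, \<open>s\<^sub>0\<close> of \<open>L\<close>, where \<open>s\<^sub>0\<close>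
  is a local trivialisation on an open set on which \<open>s\<close> does not vanish. So the known degree of
  the divisors of \<open>\<sigma>\<close> and \<open>s\<^sub>0\<close> determines that of \<open>s\<close>.\<close>

lemma vanishing_order_le_degree:
  assumes i: "i > 0" and s: "s \<in> global_sections UNIV n (tensor_power L i)" and nz: "s c P0 \<noteq> 0"
    and p: "p < num_charts L" "P \<in> chart L p" "s p \<in> max_ideal_power n C P N"
  shows "int N \<le> int i * d"
proof -
  have s_regular: "regular_on UNIV n (chart L a) (s a)" if "a < num_charts L" for a
    using global_sectionsD(1)[OF s] that by simp
  have s_cocycle: "s a Q = transition L a b Q ^ i * s b Q"
    if "a < num_charts L" "b < num_charts L" "Q \<in> chart L a" "Q \<in> chart L b" for a b Q
    using global_sectionsD(2)[OF s, of a b Q] that by simp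
  have c: "c < num_charts L" "P0 \<in> chart L c"
    using global_sectionsD(3)[OF s, of c P0] nz by auto
  obtain k where k: "i = Suc k" using i by (cases i) auto
  define V where "V = {Q \<in> chart L c. s c Q \<noteq> 0}"
  have V: "openin (geom_top n C) V" "P0 \<in> V" and Vc: "V \<subseteq> chart L c"
    unfolding V_def using openin_geom_nonzero[OF openin_chart[OF c(1)] s_regular[OF c(1)]] c nz by auto
  \<comment> \<open>In the chart \<open>c\<close> this section is the constant \<open>1\<close>,
    since the cocycle rule makes \<open>transition L c c\<close> equal to \<open>1\<close>.\<close>
  define s0 where "s0 = (\<lambda>a. transition L a c)"
  \<comment> \<open>Under a change of chart \<open>s\<close> picks up the \<open>i\<close>-th power
    of the transition function and the divisor \<open>s0 ^ k\<close> its \<open>k\<close>-th power.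
    With \<open>i = k + 1\<close> exactly one factor remains, so this is a section of
    \<open>L\<close>.\<close>
  define \<sigma> where "\<sigma> = (\<lambda>a Q. s a Q * (1 / s0 a Q) ^ k)"
  have s0_regular: "regular_on UNIV n (V \<inter> chart L a) (s0 a)" if "a < num_charts L" for a
    unfolding s0_def by (rule regular_on_subset[OF transition_regular[OF that c(1)]]) (use Vc in auto)
  have s0_nonzero: "s0 a Q \<noteq> 0" if "a < num_charts L" "Q \<in> V \<inter> chart L a" for a Q
    unfolding s0_def using that Vc c(1) by (intro transition_nonzero) auto
  have s0_cocycle: "s0 a Q = transition L a b Q * s0 b Q"
    if "a < num_charts L" "b < num_charts L" "Q \<in> V \<inter> chart L a \<inter> chart L b" for a b Q
    unfolding s0_def using that Vc c(1) by (intro transition_cocycle) auto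
  have "nonzero_rational_section n C L V s0"
    unfolding nonzero_rational_section_def
    using V s0_regular s0_cocycle s0_nonzero[OF c(1), of P0] c by blast
  then obtain E0 where E0: "section_divisor n C L V s0 E0" "(\<Sum>Q | E0 Q \<noteq> 0. E0 Q) = d"
    using degree unfolding has_degree_def by blast
  have "nonzero_rational_section n C L V \<sigma>"
    unfolding nonzero_rational_section_def
  proof (intro conjI allI impI ballI)
    show "openin (geom_top n C) V" by (rule V(1))
  next
    fix a assume a: "a < num_charts L"
    have "V \<inter> chart L a \<subseteq> proj_space n" using chart_subset[OF a] subset_proj_space by blast
    then show "regular_on UNIV n (V \<inter> chart L a) (\<sigma> a)"
      unfolding \<sigma>_def using a s0_nonzero[OF a]
      by (intro regular_on_mult regular_on_power regular_on_inverse s0_regular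
          regular_on_subset[OF s_regular[OF a]]) auto
  next
    fix a b Q assume *: "a < num_charts L" "b < num_charts L" "Q \<in> V \<inter> chart L a \<inter> chart L b"
    have "transition L a b Q \<noteq> 0" using * by (intro transition_nonzero) auto
    moreover have "s a Q = transition L a b Q ^ i * s b Q" using * by (intro s_cocycle) auto
    ultimately show "\<sigma> a Q = transition L a b Q * \<sigma> b Q"
      using s0_cocycle[OF *] by (simp add: \<sigma>_def k power_mult_distrib power_divide)
  next
    show "\<exists>a<num_charts L. \<exists>Q\<in>V \<inter> chart L a. \<sigma> a Q \<noteq> 0"
      using c V(2) nz s0_nonzero[OF c(1), of P0]
      by (intro exI[of _ c] conjI bexI[of _ P0]) (auto simp: \<sigma>_def)
  qed
  then obtain E1 where E1: "section_divisor n C L V \<sigma> E1" "(\<Sum>Q | E1 Q \<noteq> 0. E1 Q) = d"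
    using degree unfolding has_degree_def by blast

  \<comment> \<open>The equation \<open>s = \<sigma> * s0 ^ k\<close> is compared at
    \<open>Q\<close> after clearing the denominators \<open>h1\<close> and \<open>h0 ^ k\<close> of
    the local descriptions.\<close>
  have order: "int M \<le> E1 Q + int k * E0 Q"
    if b: "b < num_charts L" "Q \<in> chart L b" and M: "s b \<in> max_ideal_power n C Q M" for b Q M
  proof -
    have Q: "Q \<in> C" using chart_subset b by blast
    obtain t where "smooth_point n C Q t" using Q by (rule smooth_pointE)
    then interpret sp: smooth_point n C Q t .
    have "rational_order n C V Q (s0 b) (E0 Q)" using E0(1) b by (simp add: section_divisor_def)
    then obtain g0 h0 W0 a0 b0 where 0: "openin (geom_top n C) W0" "Q \<in> W0"
      "germ_order n C Q g0 a0" "germ_order n C Q h0 b0" "\<forall>R\<in>V \<inter> W0. s0 b R * h0 R = g0 R"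
      "E0 Q = int a0 - int b0"
      unfolding rational_order_def by blast
    have "rational_order n C V Q (\<sigma> b) (E1 Q)" using E1(1) b by (simp add: section_divisor_def)
    then obtain g1 h1 W1 a1 b1 where 1: "openin (geom_top n C) W1" "Q \<in> W1"
      "germ_order n C Q g1 a1" "germ_order n C Q h1 b1" "\<forall>R\<in>V \<inter> W1. \<sigma> b R * h1 R = g1 R"
      "E1 Q = int a1 - int b1"
      unfolding rational_order_def by blast
    let ?h = "\<lambda>R. h1 R * h0 R ^ k" and ?g = "\<lambda>R. g1 R * g0 R ^ k"
    have h: "germ_order n C Q ?h (b1 + k * b0)" and g: "germ_order n C Q ?g (a1 + k * a0)"
      by (intro sp.germ_order_mult sp.germ_order_power 0 1)+
    have reg: "regular_at n C Q (\<lambda>R. s b R * ?h R)" "regular_at n C Q ?g"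
      using regular_on_imp_regular_at[OF openin_chart[OF b(1)] b(2) s_regular[OF b(1)]]
        max_ideal_power_regular[OF sp.germ_order_mem[OF h]]
        max_ideal_power_regular[OF sp.germ_order_mem[OF g]] by (auto intro: regular_at_mult)
    have "\<forall>\<^sub>F R in near Q. R \<in> W0 \<inter> (W1 \<inter> chart L b)"
      by (rule eventually_near_open) (intro openin_Int 0 1 openin_chart b, use 0 1 b in blast)
    then have "\<forall>\<^sub>F R in near Q. R \<in> V \<longrightarrow> s b R * ?h R = ?g R"
    proof eventually_elim
      case (elim R)
      show ?case
      proof
        assume R: "R \<in> V"
        have "?g R = \<sigma> b R * h1 R * (s0 b R * h0 R) ^ k"
          using 0(5) 1(5) R elim by simp
        also have "\<dots> = s b R * ?h R"
          using s0_nonzero[OF b(1), of R] R elim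
          by (simp add: \<sigma>_def power_mult_distrib power_divide)
        finally show "s b R * ?h R = ?g R" ..
      qed
    qed
    \<comment> \<open>The point \<open>Q\<close> may be a zero of \<open>s\<close> and so lie
      outside \<open>V\<close>; the identity theorem removes the restriction to
      \<open>V\<close>.\<close>
    then have "\<forall>\<^sub>F R in near Q. s b R * ?h R = ?g R"
      by (rule eventually_eq_if_eq_on_open[OF V Q reg])
    then have "M + (b1 + k * b0) \<le> a1 + k * a0" by (rule sp.germ_order_le[OF M h g])
    then have "int (M + (b1 + k * b0)) \<le> int (a1 + k * a0)" by (rule of_nat_mono)
    then show ?thesis unfolding 0(6) 1(6) by (simp add: algebra_simps)
  qed

  \<comment> \<open>\<open>P\<close> is inserted so that its term occurs in the sum even when both
    divisors have coefficient zero there.\<close>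
  define S where "S = insert P ({Q. E0 Q \<noteq> 0} \<union> {Q. E1 Q \<noteq> 0})"
  have fin: "finite S" using E0(1) E1(1) by (simp add: S_def section_divisor_def)
  have sum0: "(\<Sum>Q\<in>S. E0 Q) = d"
    unfolding E0(2)[symmetric] using fin by (intro sum.mono_neutral_right) (auto simp: S_def)
  have sum1: "(\<Sum>Q\<in>S. E1 Q) = d"
    unfolding E1(2)[symmetric] using fin by (intro sum.mono_neutral_right) (auto simp: S_def)
  \<comment> \<open>Regularity of \<open>s\<close> is the case \<open>M = 0\<close> of the order
    estimate; off the curve both divisors are zero.\<close>
  have nonneg: "0 \<le> E1 Q + int k * E0 Q" for Q
  proof (cases "Q \<in> C")
    case True
    then obtain b where b: "b < num_charts L" "Q \<in> chart L b" by (rule in_chartE)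
    have "regular_at n C Q (s b)"
      by (rule regular_on_imp_regular_at[OF openin_chart[OF b(1)] b(2) s_regular[OF b(1)]])
    then show ?thesis using order[OF b, of 0] by simp
  next
    case False
    then show ?thesis using E0(1) E1(1) by (simp add: section_divisor_def)
  qed
  have "int N \<le> E1 P + int k * E0 P" by (rule order[OF p])
  also have "\<dots> \<le> (\<Sum>Q\<in>S. E1 Q + int k * E0 Q)"
    by (rule member_le_sum) (use fin nonneg in \<open>auto simp: S_def\<close>)
  also have "\<dots> = (\<Sum>Q\<in>S. E1 Q) + int k * (\<Sum>Q\<in>S. E0 Q)"
    by (simp add: sum.distrib sum_distrib_left)
  also have "\<dots> = int i * d" by (simp add: sum0 sum1 k algebra_simps)
  finally show ?thesis .
qed

text \<open>The high order of vanishing is arranged at \<open>P\<close> in the chart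
  \<open>p\<close>, whereas independence gives a nonzero value at a possibly different point and in
  a different chart. The two are brought together by
  \<open>vanishing_order_le_degree\<close>.\<close>

lemma independent_sections_bound:
  assumes i: "i > 0" and d: "d \<ge> 0" and ne: "C \<noteq> {}"
    and s: "\<And>j. j < m \<Longrightarrow> s j \<in> global_sections UNIV n (tensor_power L i)"
    and indep: "\<And>c. \<forall>a P. (\<Sum>j<m. c j * s j a P) = 0 \<Longrightarrow> \<forall>j<m. c j = 0"
  shows "int m \<le> int i * d + 1"
proof (rule ccontr)
  assume "\<not> int m \<le> int i * d + 1"
  define N where "N = nat (int i * d + 1)"
  have N: "int N = int i * d + 1" using d by (simp add: N_def)
  then have m: "N < card {..<m}" using \<open>\<not> int m \<le> int i * d + 1\<close> by simp
  obtain P where P: "P \<in> C" using ne by blast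
  then obtain p where p: "p < num_charts L" "P \<in> chart L p" by (rule in_chartE)
  obtain t where "smooth_point n C P t" using P by (rule smooth_pointE)
  then interpret sp: smooth_point n C P t .
  have reg: "regular_at n C P (s j p)" if "j \<in> {..<m}" for j
  proof (rule regular_on_imp_regular_at[OF openin_chart[OF p(1)] p(2)])
    show "regular_on UNIV n (chart L p) (s j p)"
      using global_sectionsD(1)[OF s, of j p] that p(1) by simp
  qed
  have "\<exists>c. (\<exists>j\<in>{..<m}. c j \<noteq> 0) \<and>
      (\<lambda>Q. \<Sum>j<m. c j * s j p Q) \<in> max_ideal_power n C P N"
    using finite_lessThan m reg by (rule sp.exists_vanishing_combination)
  then obtain c where c: "\<exists>j\<in>{..<m}. c j \<noteq> 0"
    "(\<lambda>Q. \<Sum>j<m. c j * s j p Q) \<in> max_ideal_power n C P N"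
    by (elim exE conjE)
  let ?s = "\<lambda>a Q. \<Sum>j<m. c j * s j a Q"
  obtain a Q where "?s a Q \<noteq> 0" using indep[of c] c(1) by blast
  moreover have "?s \<in> global_sections UNIV n (tensor_power L i)"
    by (rule global_sections_linear_combination) (use s in simp)
  ultimately have "int N \<le> int i * d"
    using vanishing_order_le_degree[OF i _ _ p, of ?s] c(2) by blast
  then show False using N by simp
qed

end

section \<open>Field automorphisms acting on points and sections\<close>

context field_automorphism
begin

abbreviation \<tau>' :: "'a \<Rightarrow> 'a" where
  "\<tau>' \<equiv> inv_into UNIV \<tau>"

lemma map_point_inv [simp]:
  "map_point \<tau>' (map_point \<tau> P) = P" "map_point \<tau> (map_point \<tau>' P) = P"
  by (simp_all add: map_point_def image_image o_def)

lemma inj_map_point: "inj (map_point \<tau>)"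
  by (rule inj_on_inverseI) (rule map_point_inv(1))

lemma comp_in_map_point: "x \<in> P \<Longrightarrow> \<tau> \<circ> x \<in> map_point \<tau> P"
  by (auto simp: map_point_def)

lemma comp_inv_in_point: "y \<in> P \<Longrightarrow> \<exists>x\<in>map_point \<tau>' P. y = \<tau> \<circ> x"
  by (auto simp: map_point_def fun_eq_iff intro!: exI[of _ y])

lemma map_point_proj_space:
  assumes "P \<in> proj_space n"
  shows "map_point \<tau> P \<in> proj_space n"
proof -
  obtain x where x: "\<exists>i\<le>n. x i \<noteq> 0" "\<forall>i>n. x i = 0" "P = {\<lambda>i. c * x i | c. c \<noteq> 0}"
    using assms by (auto simp: proj_space_def)
  have img: "map_point \<tau> P = {\<lambda>i. c * \<tau> (x i) | c. c \<noteq> 0}"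
  proof (intro equalityI subsetI)
    fix y assume "y \<in> map_point \<tau> P"
    then obtain c where "c \<noteq> 0" "y = \<tau> \<circ> (\<lambda>i. c * x i)" using x(3) by (auto simp: map_point_def)
    then have "\<tau> c \<noteq> 0" "y = (\<lambda>i. \<tau> c * \<tau> (x i))" by (simp_all add: fun_eq_iff mult)
    then show "y \<in> {\<lambda>i. c * \<tau> (x i) | c. c \<noteq> 0}" by blast
  next
    fix y assume "y \<in> {\<lambda>i. c * \<tau> (x i) | c. c \<noteq> 0}"
    then obtain c where "c \<noteq> 0" and y: "y = (\<lambda>i. c * \<tau> (x i))" by blast
    then have "\<tau>' c \<noteq> 0" by (metis inv_inv(2) zero)
    then have "(\<lambda>i. \<tau>' c * x i) \<in> P" using x(3) by blast
    moreover have "y = \<tau> \<circ> (\<lambda>i. \<tau>' c * x i)" by (simp add: y fun_eq_iff mult)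
    ultimately show "y \<in> map_point \<tau> P" by (simp add: map_point_def)
  qed
  have "\<exists>i\<le>n. \<tau> (x i) \<noteq> 0" "\<forall>i>n. \<tau> (x i) = 0" using x by auto
  then show ?thesis
    unfolding proj_space_def mem_Collect_eq
    by (intro exI[of _ "\<lambda>i. \<tau> (x i)"] conjI img)
qed

lemma map_point_proj_space_iff: "map_point \<tau> P \<in> proj_space n \<longleftrightarrow> P \<in> proj_space n"
  using map_point_proj_space
    field_automorphism.map_point_proj_space[OF field_automorphism_inv, of "map_point \<tau> P"] by auto

lemma monomial_comp: "(\<Prod>i\<le>n. (\<tau> \<circ> x) i ^ m i) = \<tau> (\<Prod>i\<le>n. x i ^ m i)"
  by (simp add: prod power)

text \<open>When \<open>\<tau>\<close> merely preserves \<open>K\<close>, the coefficients move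
  along with the point. When it fixes \<open>K\<close> elementwise, as in
  \<open>forms_fixed\<close>, the form stays the same.\<close>

lemma forms_twist:
  assumes "F \<in> forms K n d" "\<tau> ` K \<subseteq> K"
  obtains F' where "F' \<in> forms K n d" "\<And>x. F' (\<tau> \<circ> x) = \<tau> (F x)"
proof -
  obtain c where F: "F = (\<lambda>x. \<Sum>m\<in>exponents n d. c m * (\<Prod>i\<le>n. x i ^ m i))" and c: "range c \<subseteq> K"
    using assms(1) by (auto simp: forms_def)
  let ?F = "\<lambda>x. \<Sum>m\<in>exponents n d. (\<tau> \<circ> c) m * (\<Prod>i\<le>n. x i ^ m i)"
  have "range (\<tau> \<circ> c) \<subseteq> K" using c assms(2) by auto
  then have "?F \<in> forms K n d" unfolding forms_def by blast
  moreover have "?F (\<tau> \<circ> x) = \<tau> (F x)" for x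
    unfolding F monomial_comp by (simp add: sum mult)
  ultimately show thesis by (rule that)
qed

lemma forms_fixed:
  assumes "F \<in> forms K n d" "\<And>a. a \<in> K \<Longrightarrow> \<tau> a = a"
  shows "F (\<tau> \<circ> x) = \<tau> (F x)"
proof -
  obtain c where F: "F = (\<lambda>x. \<Sum>m\<in>exponents n d. c m * (\<Prod>i\<le>n. x i ^ m i))" and c: "range c \<subseteq> K"
    using assms(1) by (auto simp: forms_def)
  have "\<tau> (c m) = c m" for m using c assms(2) by blast
  then show ?thesis unfolding F monomial_comp by (simp add: sum mult)
qed

lemma map_point_basic_open_iff:
  assumes "\<And>x. F' (\<tau> \<circ> x) = \<tau> (F x)"
  shows "map_point \<tau> P \<in> basic_open n F' \<longleftrightarrow> P \<in> basic_open n F"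
proof -
  have "(\<forall>x\<in>map_point \<tau> P. F' x \<noteq> 0) \<longleftrightarrow> (\<forall>x\<in>P. F x \<noteq> 0)" by (simp add: map_point_def assms)
  then show ?thesis by (simp add: basic_open_def map_point_proj_space_iff)
qed

text \<open>The map on points need not be given by polynomials, as for the inverse Frobenius. It
  still carries basic open sets to basic open sets, those of the twisted forms.\<close>

lemma openin_zariski_vimage:
  assumes "openin (zariski UNIV n) U"
  shows "openin (zariski UNIV n) (map_point \<tau>' -` U)"
proof -
  have "generate_topology_on {basic_open n F | F d. F \<in> forms UNIV n d} U"
    using assms unfolding zariski_def by (rule openin_topology_generated_by)
  then show ?thesis
  proof (induction rule: generate_topology_on.induct)
    case (UN \<U>)
    have "map_point \<tau>' -` \<Union>\<U> = (\<Union>U\<in>\<U>. map_point \<tau>' -` U)" by blast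
    then show ?case using UN by auto
  next
    case (Basis U)
    then obtain F d where F: "F \<in> forms UNIV n d" and U: "U = basic_open n F" by blast
    obtain F' where F': "F' \<in> forms UNIV n d" "\<And>x. F' (\<tau> \<circ> x) = \<tau> (F x)"
      using forms_twist[OF F] by blast
    have "map_point \<tau>' P \<in> U \<longleftrightarrow> P \<in> basic_open n F'" for P
      using map_point_basic_open_iff[of F' F "map_point \<tau>' P" n, OF F'(2)] by (simp add: U)
    then have "map_point \<tau>' -` U = basic_open n F'" by blast
    then show ?case using openin_basic_open[OF F'(1)] by simp
  qed (auto simp: vimage_Int)
qed

lemma openin_zariski_fixed:
  assumes fixed: "\<And>a. a \<in> K \<Longrightarrow> \<tau> a = a" and U: "openin (zariski K n) U"
  shows "map_point \<tau> P \<in> U \<longleftrightarrow> P \<in> U"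
proof -
  have "generate_topology_on {basic_open n F | F d. F \<in> forms K n d} U"
    using U unfolding zariski_def by (rule openin_topology_generated_by)
  then show ?thesis
  proof (induction rule: generate_topology_on.induct)
    case (Basis U)
    then obtain F d where F: "F \<in> forms K n d" and U: "U = basic_open n F" by blast
    show ?case unfolding U by (rule map_point_basic_open_iff) (rule forms_fixed[OF F fixed])
  qed auto
qed

lemma closedin_zariski_fixed:
  assumes fixed: "\<And>a. a \<in> K \<Longrightarrow> \<tau> a = a" and C: "closedin (zariski K n) C"
  shows "map_point \<tau> P \<in> C \<longleftrightarrow> P \<in> C"
proof -
  let ?T = "topspace (zariski K n)"
  have "C = ?T - (?T - C)" using closedin_subset[OF C] by blast
  moreover have "map_point \<tau> P \<in> ?T \<longleftrightarrow> P \<in> ?T"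
    by (rule openin_zariski_fixed[OF fixed openin_topspace])
  moreover have T: "openin (zariski K n) (?T - C)" using C by (simp add: closedin_def)
  have "map_point \<tau> P \<in> ?T - C \<longleftrightarrow> P \<in> ?T - C" by (rule openin_zariski_fixed[OF fixed T])
  ultimately show ?thesis by blast
qed

text \<open>A fraction valid at \<open>P\<close> remains valid at the image of \<open>P\<close>: its
  denominator commutes with \<open>\<tau>\<close> and hence stays nonzero.\<close>

lemma regular_on_fixed:
  assumes fixed: "\<And>a. a \<in> K \<Longrightarrow> \<tau> a = a" and f: "regular_on K n U f"
    and P: "P \<in> U" "map_point \<tau> P \<in> U" "P \<in> proj_space n"
  shows "f (map_point \<tau> P) = \<tau> (f P)"
proof -
  obtain d F G where 1: "F \<in> forms K n d" "G \<in> forms K n d" "\<forall>x\<in>P. G x \<noteq> 0"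
    "\<forall>Q\<in>U. \<forall>x\<in>Q. G x \<noteq> 0 \<longrightarrow> f Q = F x / G x"
    using f P(1) by (rule regular_onE)
  obtain x where x: "x \<in> P" using proj_space_nonempty[OF P(3)] by blast
  have F: "F (\<tau> \<circ> x) = \<tau> (F x)" and G: "G (\<tau> \<circ> x) = \<tau> (G x)"
    using forms_fixed[OF 1(1) fixed] forms_fixed[OF 1(2) fixed] by blast+
  have "f (map_point \<tau> P) = F (\<tau> \<circ> x) / G (\<tau> \<circ> x)"
    using 1(3,4) P(2) comp_in_map_point[OF x] x by (simp add: G)
  also have "\<dots> = \<tau> (F x / G x)" by (simp add: F G divide)
  also have "F x / G x = f P" using 1(3,4) P(1) x by simp
  finally show ?thesis .
qed

section \<open>The semilinear action on functions and sections\<close>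

definition conj_fun :: "('a point \<Rightarrow> 'a) \<Rightarrow> 'a point \<Rightarrow> 'a" where
  "conj_fun f P = \<tau> (f (map_point \<tau>' P))"

lemma conj_fun_map_point [simp]: "conj_fun f (map_point \<tau> P) = \<tau> (f P)"
  by (simp add: conj_fun_def)

lemma regular_on_conj:
  assumes K: "\<tau> ` K \<subseteq> K" and f: "regular_on K n U f"
  shows "regular_on K n (map_point \<tau>' -` U) (conj_fun f)"
proof (rule regular_onI)
  fix P assume "P \<in> map_point \<tau>' -` U"
  then have "map_point \<tau>' P \<in> U" by simp
  with f obtain d F G where 1: "F \<in> forms K n d" "G \<in> forms K n d"
    "\<forall>x\<in>map_point \<tau>' P. G x \<noteq> 0" "\<forall>Q\<in>U. \<forall>x\<in>Q. G x \<noteq> 0 \<longrightarrow> f Q = F x / G x"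
    by (rule regular_onE)
  obtain F' where F': "F' \<in> forms K n d" "\<And>x. F' (\<tau> \<circ> x) = \<tau> (F x)"
    using forms_twist[OF 1(1) K] by blast
  obtain G' where G': "G' \<in> forms K n d" "\<And>x. G' (\<tau> \<circ> x) = \<tau> (G x)"
    using forms_twist[OF 1(2) K] by blast
  have "G' y \<noteq> 0" if "y \<in> P" for y
    using comp_inv_in_point[OF that] 1(3) by (auto simp: G'(2))
  moreover have "conj_fun f Q = F' y / G' y"
    if Q: "Q \<in> map_point \<tau>' -` U" and y: "y \<in> Q" "G' y \<noteq> 0" for Q y
  proof -
    obtain x where x: "x \<in> map_point \<tau>' Q" "y = \<tau> \<circ> x" using comp_inv_in_point[OF y(1)] by blast
    have "G x \<noteq> 0" using y(2) by (simp add: x(2) G'(2))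
    then have "f (map_point \<tau>' Q) = F x / G x" using 1(4) Q x(1) by simp
    then show ?thesis by (simp add: conj_fun_def x(2) F'(2) G'(2) divide)
  qed
  ultimately show "\<exists>d F G. F \<in> forms K n d \<and> G \<in> forms K n d \<and> (\<forall>x\<in>P. G x \<noteq> 0) \<and>
      (\<forall>Q\<in>map_point \<tau>' -` U. \<forall>x\<in>Q. G x \<noteq> 0 \<longrightarrow> conj_fun f Q = F x / G x)"
    using F'(1) G'(1) by blast
qed

definition conj_section :: "'a sect \<Rightarrow> 'a sect" where
  "conj_section s = (\<lambda>a. conj_fun (s a))"

lemma conj_section_map_point [simp]: "conj_section s a (map_point \<tau> P) = \<tau> (s a P)"
  by (simp add: conj_section_def)

lemma conj_section_lin_comb: "conj_section (lin_comb e c) = lin_comb (map conj_section e) (\<tau> \<circ> c)"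
  by (simp add: fun_eq_iff conj_section_def conj_fun_def lin_comb_def sum mult)

lemma conj_section_eqI:
  assumes "\<And>a P. s a (map_point \<tau> P) = \<tau> (s a P)"
  shows "conj_section s = s"
proof (intro ext)
  fix a P
  show "conj_section s a P = s a P"
    using assms[of a "map_point \<tau>' P"] by (simp add: conj_section_def conj_fun_def)
qed

text \<open>Artin's argument: subtracting from a shortest relation, normalised to have a coefficient
  \<open>1\<close>, its image under \<open>\<tau>\<close> leaves a shorter one.\<close>

lemma relation_with_fixed_coefficients:
  fixes f :: "'i \<Rightarrow> 'x \<Rightarrow> 'a"
  assumes "finite I" and equiv: "\<And>j x. j \<in> I \<Longrightarrow> f j (\<pi> x) = \<tau> (f j x)" and surj: "surj \<pi>"
    and "\<exists>j\<in>I. c j \<noteq> 0" and "\<And>x. (\<Sum>j\<in>I. c j * f j x) = 0"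
  shows "\<exists>c'. (\<forall>j\<in>I. \<tau> (c' j) = c' j) \<and> (\<exists>j\<in>I. c' j \<noteq> 0) \<and> (\<forall>x. (\<Sum>j\<in>I. c' j * f j x) = 0)"
  using assms(4,5)
proof (induction "card {j \<in> I. c j \<noteq> 0}" arbitrary: c rule: less_induct)
  case less
  obtain r where r: "r \<in> I" "c r \<noteq> 0" using less.prems(1) by blast
  let ?c = "\<lambda>j. c j / c r"
  have rel: "(\<Sum>j\<in>I. ?c j * f j x) = 0" for x
    using less.prems(2)[of x] by (simp add: sum_divide_distrib[symmetric])
  have "(\<Sum>j\<in>I. \<tau> (?c j) * f j y) = 0" for y
  proof -
    obtain x where y: "y = \<pi> x" using surj by blast
    have "(\<Sum>j\<in>I. \<tau> (?c j) * f j y) = \<tau> (\<Sum>j\<in>I. ?c j * f j x)"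
      unfolding sum mult y by (rule sum.cong) (simp_all add: equiv)
    then show ?thesis using rel[of x] by simp
  qed
  then have rel': "(\<Sum>j\<in>I. (\<tau> (?c j) - ?c j) * f j x) = 0" for x
    using rel[of x] by (simp only: left_diff_distrib sum_subtractf) simp
  show ?case
  proof (cases "\<forall>j\<in>I. \<tau> (?c j) = ?c j")
    case True
    then show ?thesis using rel r by (intro exI[of _ ?c]) auto
  next
    case False
    \<comment> \<open>The normalised coefficient at \<open>r\<close> is \<open>1\<close> and
      cancels, while coefficients that are zero stay zero.\<close>
    have "{j \<in> I. \<tau> (?c j) - ?c j \<noteq> 0} \<subseteq> {j \<in> I. c j \<noteq> 0} - {r}" using r by auto
    then have "card {j \<in> I. \<tau> (?c j) - ?c j \<noteq> 0} \<le> card ({j \<in> I. c j \<noteq> 0} - {r})"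
      using \<open>finite I\<close> by (intro card_mono) auto
    also have "\<dots> < card {j \<in> I. c j \<noteq> 0}"
      using r \<open>finite I\<close> by (intro card_Diff1_less) auto
    finally show ?thesis
      by (rule less.hyps) (use False rel' in auto)
  qed
qed

end

section \<open>Bundles invariant under a field automorphism\<close>

lemma count_image_mset_inj: "inj f \<Longrightarrow> count (image_mset f D) (f x) = count D x"
  by (induction D) (auto simp: inj_eq)

text \<open>Invariance is stated without reference to a base field, so that it passes to the inverse
  automorphism and to tensor powers.\<close>

locale equivariant_bundle = field_automorphism \<tau>
  for \<tau> :: "'a::field \<Rightarrow> 'a" +
  fixes C :: "'a point set" and L :: "'a line_bundle"
  assumes curve_stable: "map_point \<tau> P \<in> C \<longleftrightarrow> P \<in> C"
    and chart_stable: "a < num_charts L \<Longrightarrow> map_point \<tau> P \<in> chart L a \<longleftrightarrow> P \<in> chart L a"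
    and transition_equivariant: "a < num_charts L \<Longrightarrow> b < num_charts L \<Longrightarrow>
      P \<in> chart L a \<Longrightarrow> P \<in> chart L b \<Longrightarrow> transition L a b (map_point \<tau> P) = \<tau> (transition L a b P)"
begin

lemma equivariant_bundle_inv: "equivariant_bundle (inv_into UNIV \<tau>) C L"
proof -
  interpret inv: field_automorphism "inv_into UNIV \<tau>" by (rule field_automorphism_inv)
  show ?thesis
  proof
    show "map_point \<tau>' P \<in> C \<longleftrightarrow> P \<in> C" for P
      using curve_stable[of "map_point \<tau>' P"] by simp
    show *: "map_point \<tau>' P \<in> chart L a \<longleftrightarrow> P \<in> chart L a" if "a < num_charts L" for a P
      using chart_stable[OF that, of "map_point \<tau>' P"] by simp
    show "transition L a b (map_point \<tau>' P) = \<tau>' (transition L a b P)"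
      if "a < num_charts L" "b < num_charts L" "P \<in> chart L a" "P \<in> chart L b" for a b P
    proof -
      have eq: "transition L a b P = \<tau> (transition L a b (map_point \<tau>' P))"
        using transition_equivariant[OF that(1,2), of "map_point \<tau>' P"] that * by simp
      show ?thesis by (simp only: eq inv_inv)
    qed
  qed
qed

lemma equivariant_bundle_tensor_power: "equivariant_bundle \<tau> C (tensor_power L i)"
  by unfold_locales (simp_all add: curve_stable chart_stable transition_equivariant power)

lemma map_point_inv_in_chart_iff:
  "a < num_charts L \<Longrightarrow> map_point \<tau>' P \<in> chart L a \<longleftrightarrow> P \<in> chart L a"
  using chart_stable[of a "map_point \<tau>' P"] by simp

lemma openin_geom_vimage:
  assumes "openin (geom_top n C) W"
  shows "openin (geom_top n C) (map_point \<tau>' -` W)"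
proof -
  obtain T where "openin (zariski UNIV n) T" "W = T \<inter> C"
    using assms by (auto simp: openin_subtopology)
  moreover have "map_point \<tau>' -` C = C" using curve_stable[of "map_point \<tau>' P" for P] by auto
  ultimately show ?thesis
    unfolding openin_subtopology using openin_zariski_vimage by (metis vimage_Int)
qed

lemma regular_at_conj:
  assumes "regular_at n C P f"
  shows "regular_at n C (map_point \<tau> P) (conj_fun f)"
proof -
  obtain W where W: "openin (geom_top n C) W" "P \<in> W" "regular_on UNIV n W f"
    using assms unfolding regular_at_def by blast
  have "regular_on UNIV n (map_point \<tau>' -` W) (conj_fun f)"
    by (rule regular_on_conj[OF _ W(3)]) simp
  then show ?thesis
    unfolding regular_at_def using openin_geom_vimage[OF W(1)] W(2)
    by (intro exI[of _ "map_point \<tau>' -` W"]) simp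
qed

lemma eq_near_conj:
  assumes "eq_near n C P f h"
  shows "eq_near n C (map_point \<tau> P) (conj_fun f) (conj_fun h)"
proof -
  obtain W where W: "openin (geom_top n C) W" "P \<in> W" "\<forall>Q\<in>W. f Q = h Q"
    using assms unfolding eq_near_def by blast
  then show ?thesis
    unfolding eq_near_def using openin_geom_vimage[OF W(1)]
    by (intro exI[of _ "map_point \<tau>' -` W"]) (simp add: conj_fun_def)
qed

lemma max_ideal_power_conj:
  assumes "f \<in> max_ideal_power n C P m"
  shows "conj_fun f \<in> max_ideal_power n C (map_point \<tau> P) m"
  using assms
proof (induction m arbitrary: f)
  case 0
  then show ?case by (simp add: regular_at_conj)
next
  case (Suc m)
  obtain N :: nat and g h where gh: "\<forall>j<N. g j \<in> max_ideal_power n C P m \<and> regular_at n C P (h j) \<and> h j P = 0"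
    and f: "regular_at n C P f" "eq_near n C P f (\<lambda>Q. \<Sum>j<N. g j Q * h j Q)"
    using Suc.prems by (auto simp: max_ideal_power.simps(2))
  have "conj_fun (\<lambda>Q. \<Sum>j<N. g j Q * h j Q) = (\<lambda>Q. \<Sum>j<N. conj_fun (g j) Q * conj_fun (h j) Q)"
    by (simp add: fun_eq_iff conj_fun_def sum mult)
  then have "eq_near n C (map_point \<tau> P) (conj_fun f)
      (\<lambda>Q. \<Sum>j<N. conj_fun (g j) Q * conj_fun (h j) Q)"
    using eq_near_conj[OF f(2)] by simp
  moreover have "\<forall>j<N. conj_fun (g j) \<in> max_ideal_power n C (map_point \<tau> P) m \<and>
      regular_at n C (map_point \<tau> P) (conj_fun (h j)) \<and> conj_fun (h j) (map_point \<tau> P) = 0"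
    using gh by (simp add: Suc.IH regular_at_conj)
  ultimately show ?case
    unfolding max_ideal_power.simps(2) mem_Collect_eq using regular_at_conj[OF f(1)]
    by (intro conjI exI[where x = N] exI[where x = "\<lambda>j. conj_fun (g j)"]
        exI[where x = "\<lambda>j. conj_fun (h j)"])
qed

lemma global_sections_conj:
  assumes K: "\<tau> ` K \<subseteq> K" and s: "s \<in> global_sections K n L"
  shows "conj_section s \<in> global_sections K n L"
  unfolding global_sections_def mem_Collect_eq
proof (intro conjI allI impI ballI)
  fix a assume a: "a < num_charts L"
  have "map_point \<tau>' -` chart L a = chart L a" using map_point_inv_in_chart_iff[OF a] by auto
  then show "regular_on K n (chart L a) (conj_section s a)"
    using regular_on_conj[OF K global_sectionsD(1)[OF s a]] by (simp add: conj_section_def)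
next
  fix a b P assume *: "a < num_charts L" "b < num_charts L" "P \<in> chart L a \<inter> chart L b"
  let ?P = "map_point \<tau>' P"
  have P: "?P \<in> chart L a" "?P \<in> chart L b" using * by (simp_all add: map_point_inv_in_chart_iff)
  have "transition L a b P = \<tau> (transition L a b ?P)"
    using transition_equivariant[OF *(1,2) P] by simp
  moreover have "s a ?P = transition L a b ?P * s b ?P"
    by (rule global_sectionsD(2)[OF s *(1,2) P])
  ultimately show "conj_section s a P = transition L a b P * conj_section s b P"
    by (simp only: conj_section_def conj_fun_def mult)
next
  fix a P assume "\<not> (a < num_charts L \<and> P \<in> chart L a)"
  then have "\<not> (a < num_charts L \<and> map_point \<tau>' P \<in> chart L a)"
    by (auto simp: map_point_inv_in_chart_iff)
  then show "conj_section s a P = 0"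
    using global_sectionsD(3)[OF s] by (simp add: conj_section_def conj_fun_def)
qed

text \<open>Conjugation moves germs at a point to germs at its image with the same power of the
  maximal ideal, and by injectivity on points the multiplicities of the divisor move in the same
  way.\<close>

lemma sections_vanishing_conj:
  assumes K: "\<tau> ` K \<subseteq> K" and s: "s \<in> sections_vanishing K n C L D"
  shows "conj_section s \<in> sections_vanishing K n C L (image_mset (map_point \<tau>) D)"
  unfolding sections_vanishing_def mem_Collect_eq
proof (intro conjI allI impI ballI)
  show "conj_section s \<in> global_sections K n L"
    by (rule global_sections_conj[OF K]) (use s in \<open>simp add: sections_vanishing_def\<close>)
next
  fix a P assume a: "a < num_charts L" "P \<in> chart L a"
  let ?P = "map_point \<tau>' P"
  have "?P \<in> chart L a" using a by (simp add: map_point_inv_in_chart_iff)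
  then have "s a \<in> max_ideal_power n C ?P (count D ?P)"
    using s a(1) by (simp add: sections_vanishing_def)
  then have "conj_fun (s a) \<in> max_ideal_power n C (map_point \<tau> ?P) (count D ?P)"
    by (rule max_ideal_power_conj)
  moreover have "count (image_mset (map_point \<tau>) D) P = count D ?P"
    using count_image_mset_inj[OF inj_map_point, of D ?P] by simp
  ultimately show "conj_section s a \<in> max_ideal_power n C P (count (image_mset (map_point \<tau>) D) P)"
    by (simp add: conj_section_def)
qed

text \<open>Serves two purposes: with the Frobenius of \<open>k\<close> it shows that the basis
  \<open>e\<close> is unchanged by conjugation, and with the Frobenius of any finite field of
  definition it gives the equivariance needed for Artin's lemma. Outside the charts both sides are
  zero by the default value of sections.\<close>

lemma global_sections_fixed:
  assumes fixed: "\<And>a. a \<in> K \<Longrightarrow> \<tau> a = a" and s: "s \<in> global_sections K n L"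
    and L: "\<And>a. a < num_charts L \<Longrightarrow> chart L a \<subseteq> proj_space n"
  shows "s a (map_point \<tau> P) = \<tau> (s a P)"
proof (cases "a < num_charts L \<and> P \<in> chart L a")
  case True
  then have a: "a < num_charts L" and P: "P \<in> chart L a" by simp_all
  show ?thesis
    by (rule regular_on_fixed[OF fixed global_sectionsD(1)[OF s a]])
      (use P a chart_stable[OF a] L[OF a] in auto)
next
  case False
  then have "\<not> (a < num_charts L \<and> map_point \<tau> P \<in> chart L a)" by (auto simp: chart_stable)
  then show ?thesis using False global_sectionsD(3)[OF s] by simp
qed

end

lemma (in field_automorphism) equivariant_bundleI:
  assumes fixed: "\<And>a. a \<in> K \<Longrightarrow> \<tau> a = a" and C: "closedin (zariski K n) C"
    and L: "is_line_bundle K n C L"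
  shows "equivariant_bundle \<tau> C L"
proof
  show C_iff: "map_point \<tau> P \<in> C \<longleftrightarrow> P \<in> C" for P by (rule closedin_zariski_fixed[OF fixed C])
  have C_proj: "C \<subseteq> proj_space n" using closedin_subset[OF C] topspace_zariski_subset by blast
  show chart_iff: "map_point \<tau> P \<in> chart L a \<longleftrightarrow> P \<in> chart L a" if a: "a < num_charts L" for a P
  proof -
    have "openin (subtopology (zariski K n) C) (chart L a)"
      using L a unfolding is_line_bundle_def by blast
    then obtain T where T: "openin (zariski K n) T" "chart L a = T \<inter> C"
      by (auto simp: openin_subtopology)
    show ?thesis using openin_zariski_fixed[OF fixed T(1), of P] C_iff[of P] by (simp add: T(2))
  qed
  fix a b P assume *: "a < num_charts L" "b < num_charts L" "P \<in> chart L a" "P \<in> chart L b"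
  have "chart L a \<subseteq> C" using L *(1) unfolding is_line_bundle_def by blast
  then have "P \<in> proj_space n" using * C_proj by blast
  moreover have "regular_on K n (chart L a \<inter> chart L b) (transition L a b)"
    using L * unfolding is_line_bundle_def by blast
  ultimately show "transition L a b (map_point \<tau> P) = \<tau> (transition L a b P)"
    using regular_on_fixed[OF fixed, of K n "chart L a \<inter> chart L b" "transition L a b" P]
      * chart_iff by simp
qed

section \<open>Bases and the number of sections\<close>

lemma lin_comb_cong: "(\<And>j. j < length e \<Longrightarrow> c j = c' j) \<Longrightarrow> lin_comb e c = lin_comb e c'"
  by (simp add: lin_comb_def)

lemma lin_comb_restrict [simp]: "lin_comb e (restrict c {..<length e}) = lin_comb e c"
  by (rule lin_comb_cong) simp

section \<open>Enlarging the base field, and bases\<close>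

lemma is_line_bundle_mono:
  assumes K: "K \<subseteq> K'" and L: "is_line_bundle K n C L"
  shows "is_line_bundle K' n C L"
proof -
  have top: "openin (subtopology (zariski K' n) C) U"
    if "openin (subtopology (zariski K n) C) U" for U
    using that openin_zariski_mono[OF K] unfolding openin_subtopology by blast
  have 1: "\<forall>a<num_charts L. openin (subtopology (zariski K n) C) (chart L a)"
    and 2: "(\<Union>a<num_charts L. chart L a) = C"
    and 3: "\<forall>a<num_charts L. \<forall>b<num_charts L.
      regular_on K n (chart L a \<inter> chart L b) (transition L a b) \<and>
      (\<forall>P\<in>chart L a \<inter> chart L b. transition L a b P \<noteq> 0)"
    and 4: "\<forall>a<num_charts L. \<forall>b<num_charts L. \<forall>c<num_charts L.
      \<forall>P\<in>chart L a \<inter> chart L b \<inter> chart L c.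
        transition L a c P = transition L a b P * transition L b c P"
    by (rule L[unfolded is_line_bundle_def, THEN conjunct1],
      rule L[unfolded is_line_bundle_def, THEN conjunct2, THEN conjunct1],
      rule L[unfolded is_line_bundle_def, THEN conjunct2, THEN conjunct2, THEN conjunct1],
      rule L[unfolded is_line_bundle_def, THEN conjunct2, THEN conjunct2, THEN conjunct2])
  show ?thesis
    unfolding is_line_bundle_def
    by (intro conjI 2 4) (use 1 3 top regular_on_mono[OF K] in simp_all)
qed

lemma global_sections_mono:
  assumes K: "K \<subseteq> K'" and s: "s \<in> global_sections K n L"
  shows "s \<in> global_sections K' n L"
  unfolding global_sections_def mem_Collect_eq
  by (intro conjI allI impI ballI)
    (auto intro: regular_on_mono[OF K] global_sectionsD(1)[OF s] global_sectionsD(2)[OF s]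
      global_sectionsD(3)[OF s])

lemma (in field_automorphism) conj_section_inv:
  "conj_section (field_automorphism.conj_section \<tau>' s) = s"
proof -
  interpret inv: field_automorphism \<tau>' by (rule field_automorphism_inv)
  show ?thesis
    by (simp add: fun_eq_iff conj_section_def conj_fun_def inv.conj_section_def inv.conj_fun_def)
qed

text \<open>The coordinates of a conjugated section are the images of the old ones under
  \<open>\<tau>\<close>. That \<open>\<tau>\<close> maps \<open>K\<close> into itself gives
  existence of coordinates in \<open>K\<close>, and that it maps onto \<open>K\<close> gives
  uniqueness.\<close>

lemma (in field_automorphism) is_basis_conj:
  assumes K: "\<tau> ` K = K" and b: "is_basis K S b"
    and S: "\<And>s. s \<in> S \<Longrightarrow> conj_section s \<in> S'"
    and S': "\<And>s. s \<in> S' \<Longrightarrow> \<exists>r\<in>S. s = conj_section r"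
  shows "is_basis K S' (map conj_section b)"
  unfolding is_basis_def
proof
  show "set (map conj_section b) \<subseteq> S'" using b S by (auto simp: is_basis_def)
  have conj_inj: "r = r'" if "conj_section r = conj_section r'" for r r'
  proof (intro ext)
    fix a P
    have "\<tau> (r a P) = \<tau> (r' a P)" using that conj_section_map_point by metis
    then show "r a P = r' a P" by (simp add: inj)
  qed
  have inv_in: "\<tau>' a \<in> K" if "a \<in> K" for a
  proof -
    have "a \<in> \<tau> ` K" using that by (simp only: K)
    then show ?thesis by auto
  qed
  show "\<forall>s\<in>S'. \<exists>!c. c \<in> {..<length (map conj_section b)} \<rightarrow>\<^sub>E K \<and> s = lin_comb (map conj_section b) c"
  proof
    fix s assume "s \<in> S'"
    then obtain r where r: "r \<in> S" "s = conj_section r" using S' by blast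
    have ex1: "\<exists>!c. c \<in> {..<length b} \<rightarrow>\<^sub>E K \<and> r = lin_comb b c" using b r(1) by (simp add: is_basis_def)
    then obtain c where c: "c \<in> {..<length b} \<rightarrow>\<^sub>E K" "r = lin_comb b c" by blast
    have eq_iff: "s = lin_comb (map conj_section b) (\<tau> \<circ> c') \<longleftrightarrow> r = lin_comb b c'" for c'
      unfolding r(2) conj_section_lin_comb[symmetric] using conj_inj by blast
    let ?c = "restrict (\<tau> \<circ> c) {..<length b}"
    show "\<exists>!c. c \<in> {..<length (map conj_section b)} \<rightarrow>\<^sub>E K \<and> s = lin_comb (map conj_section b) c"
    proof (rule ex1I[of _ ?c])
      have "s = lin_comb (map conj_section b) ?c"
        using c(2) eq_iff[of c] lin_comb_restrict[of "map conj_section b" "\<tau> \<circ> c"] by simp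
      moreover have "?c \<in> {..<length b} \<rightarrow>\<^sub>E K" using c(1) K by (auto simp: PiE_def Pi_def)
      ultimately show "?c \<in> {..<length (map conj_section b)} \<rightarrow>\<^sub>E K \<and> s = lin_comb (map conj_section b) ?c"
        by simp
    next
      fix c' assume "c' \<in> {..<length (map conj_section b)} \<rightarrow>\<^sub>E K \<and> s = lin_comb (map conj_section b) c'"
      then have c': "c' \<in> {..<length b} \<rightarrow>\<^sub>E K" "s = lin_comb (map conj_section b) c'" by simp_all
      let ?r = "restrict (\<tau>' \<circ> c') {..<length b}"
      have "\<tau> \<circ> (\<tau>' \<circ> c') = c'" by (simp add: fun_eq_iff)
      then have "r = lin_comb b (\<tau>' \<circ> c')" using eq_iff[of "\<tau>' \<circ> c'"] c'(2) by simp
      moreover have "?r \<in> {..<length b} \<rightarrow>\<^sub>E K" using c'(1) inv_in by (auto simp: PiE_def Pi_def)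
      ultimately have r_eq: "?r = c" using ex1 c by (metis lin_comb_restrict)
      have *: "\<tau>' (c' j) = c j" if "j < length b" for j
        unfolding r_eq[symmetric] using that by simp
      show "c' = ?c"
      proof
        fix j
        show "c' j = ?c j"
        proof (cases "j < length b")
          case True
          then show ?thesis using *[OF True, symmetric] by simp
        next
          case False
          then show ?thesis using c'(1) by (simp add: PiE_arb[OF c'(1)])
        qed
      qed
    qed
  qed
qed

text \<open>Since \<open>S\<close> is an arbitrary set that may lack the zero section, uniqueness of
  coordinates is applied to \<open>e ! r\<close>: adding the relation to its obvious expansion must
  not change the coordinates.\<close>

lemma is_basis_relation_trivial:
  assumes K: "finite_subfield K" and b: "is_basis K S e"
    and c: "\<And>j. j < length e \<Longrightarrow> c j \<in> K" and rel: "\<And>a P. (\<Sum>j<length e. c j * (e ! j) a P) = 0"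
    and r: "r < length e"
  shows "c r = 0"
proof -
  let ?u = "\<lambda>j. if j = r then 1 else 0"
  let ?c1 = "restrict ?u {..<length e}" and ?c2 = "restrict (\<lambda>j. ?u j + c j) {..<length e}"
  have u: "e ! r = lin_comb e ?u"
  proof (intro ext)
    fix a P
    have "lin_comb e ?u a P = (\<Sum>j<length e. if j = r then (e ! j) a P else 0)"
      unfolding lin_comb_def by (rule sum.cong) auto
    then show "(e ! r) a P = lin_comb e ?u a P" using r by simp
  qed
  have "lin_comb e (\<lambda>j. ?u j + c j) = lin_comb e ?u"
    unfolding lin_comb_def distrib_right sum.distrib rel by simp
  then have "e ! r = lin_comb e ?c1" "e ! r = lin_comb e ?c2" by (simp_all add: u)
  moreover have "?c1 \<in> {..<length e} \<rightarrow>\<^sub>E K" "?c2 \<in> {..<length e} \<rightarrow>\<^sub>E K"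
    using K c by (auto simp: finite_subfield_def)
  moreover have "e ! r \<in> S" using b r by (auto simp: is_basis_def)
  then have "\<exists>!c. c \<in> {..<length e} \<rightarrow>\<^sub>E K \<and> e ! r = lin_comb e c" using b by (simp add: is_basis_def)
  ultimately have "?c1 = ?c2" by blast
  then have "?c1 r = ?c2 r" by (rule fun_cong)
  then show ?thesis using r by simp
qed

text \<open>Stated for any finite field \<open>K\<close> and any \<open>S\<close> because it is
  applied to \<open>e\<close> over \<open>k\<close> and to \<open>b\<close> over \<open>k'\<close>,
  the latter with the sections vanishing on the divisor.\<close>

lemma basis_length_bound:
  fixes K :: "'a::alg_closed_field set"
  assumes K: "finite_subfield K" and C: "closedin (zariski K n) C" "C \<noteq> {}"
    and smooth: "\<And>P. P \<in> C \<Longrightarrow> smooth_curve_at n C P"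
    and L: "is_line_bundle K n C L" "has_degree n C L d" and d: "d \<ge> 0" and i: "i > 0"
    and S: "S \<subseteq> global_sections K n (tensor_power L i)" and e: "is_basis K S e"
  shows "int (length e) \<le> int i * d + 1"
proof -
  have proj: "C \<subseteq> proj_space n" using closedin_subset[OF C(1)] topspace_zariski_subset by blast
  interpret curve_with_line_bundle n C L d
    using proj is_line_bundle_mono[OF subset_UNIV L(1)] L(2) smooth by unfold_locales
  let ?\<phi> = "\<lambda>a :: 'a. a ^ card K"
  interpret \<phi>: field_automorphism ?\<phi> by (rule field_automorphism_frobenius[OF K])
  have fixed: "a ^ card K = a" if "a \<in> K" for a using finite_subfield_power_card[OF K that] .
  interpret L: equivariant_bundle ?\<phi> C L using fixed C(1) L(1) by (rule \<phi>.equivariant_bundleI)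
  interpret Li: equivariant_bundle ?\<phi> C "tensor_power L i" by (rule L.equivariant_bundle_tensor_power)
  have sec: "e ! j \<in> global_sections K n (tensor_power L i)" if "j < length e" for j
    using nth_mem[OF that] e S unfolding is_basis_def by blast
  have equiv: "(e ! j) a (map_point ?\<phi> P) = ?\<phi> ((e ! j) a P)" if "j < length e" for j a P
    using fixed sec[OF that]
    by (rule Li.global_sections_fixed) (use chart_subset proj in auto)
  show ?thesis
  proof (rule independent_sections_bound[OF i d C(2)])
    show "e ! j \<in> global_sections UNIV n (tensor_power L i)" if "j < length e" for j
      by (rule global_sections_mono[OF subset_UNIV sec[OF that]])
    fix c assume c: "\<forall>a P. (\<Sum>j<length e. c j * (e ! j) a P) = 0"
    show "\<forall>j<length e. c j = 0"
    proof (rule ccontr)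
      assume "\<not> (\<forall>j<length e. c j = 0)"
      \<comment> \<open>A section is read as one function on pairs of a chart index and a point, on
        which Frobenius moves only the point; this is the setting of Artin's lemma.\<close>
      let ?\<pi> = "\<lambda>(a :: nat, P). (a, map_point ?\<phi> P)" and ?f = "\<lambda>j (a, P). (e ! j) a P"
      have "surj ?\<pi>"
        by (rule surjI[of _ "\<lambda>(a, P). (a, map_point \<phi>.\<tau>' P)"]) auto
      have "\<exists>c'. (\<forall>j\<in>{..<length e}. ?\<phi> (c' j) = c' j) \<and> (\<exists>j\<in>{..<length e}. c' j \<noteq> 0) \<and>
          (\<forall>x. (\<Sum>j<length e. c' j * ?f j x) = 0)"
        by (rule \<phi>.relation_with_fixed_coefficients[of _ ?f ?\<pi> c])
          (use \<open>surj ?\<pi>\<close> equiv c \<open>\<not> (\<forall>j<length e. c j = 0)\<close> in auto)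
      then obtain c' where c': "\<And>j. j < length e \<Longrightarrow> ?\<phi> (c' j) = c' j" "\<exists>j<length e. c' j \<noteq> 0"
        "\<And>x. (\<Sum>j<length e. c' j * ?f j x) = 0" by auto
      have "c' r = 0" if "r < length e" for r
      proof (rule is_basis_relation_trivial[OF K e _ _ that])
        show "c' j \<in> K" if "j < length e" for j
          using c'(1)[OF that] finite_subfield_eq_fixed[OF K] by blast
        show "(\<Sum>j<length e. c' j * (e ! j) a P) = 0" for a P
          using c'(3)[of "(a, P)"] by simp
      qed
      then show False using c'(2) by blast
    qed
  qed
qed

section \<open>The algorithm\<close>

lemma fst_map_counting: "fst (map_counting f xs) = map (fst \<circ> f) xs"
  by (induction xs) (auto simp: case_prod_unfold Let_def)

lemma snd_map_counting: "snd (map_counting f xs) = (\<Sum>x\<leftarrow>xs. snd (f x))"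
  by (induction xs) (auto simp: case_prod_unfold Let_def)

lemma fst_frobenius_matrix: "fst (frobenius_matrix q M) = map (map (\<lambda>a. a ^ q)) M"
  by (simp add: frobenius_matrix_def fst_map_counting qth_power_def o_def)

lemma snd_frobenius_matrix: "snd (frobenius_matrix q M) = (\<Sum>r\<leftarrow>M. length r)"
  by (simp add: frobenius_matrix_def snd_map_counting qth_power_def o_def sum_list_triv)

text \<open>The asymptotic bound is made explicit with the constant \<open>(i + 1)^2\<close>, which
  depends on the exponent \<open>i\<close> alone. The basis \<open>b'\<close> is the conjugate of
  \<open>b\<close>.\<close>

theorem mainTheorem6:
  fixes k k' :: "'k::{field,finite} alg_closure set"
    and C :: "'k alg_closure point set"
    and L :: "'k alg_closure line_bundle"
    and D :: "'k alg_closure point multiset"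
    and M :: "'k alg_closure list list"
    and b e :: "'k alg_closure sect list"
    and n g i q :: nat and d :: int
  assumes "k = range (to_ac :: 'k \<Rightarrow> 'k alg_closure)"
    and "q = card k"
    and "projective_curve k n C g L d"
    and "subfield k' ring_of_type_algebra" and "k \<subseteq> k'" and "finite k'"
    and "i > 0"
    and "effective_divisor k' C D"
    and "is_basis k (global_sections k n (tensor_power L i)) e"
    and "is_basis k' (sections_vanishing k' n C (tensor_power L i) D) b"
    and "inclusion_matrix k' b e M"
  shows "(\<exists>b'. is_basis k' (sections_vanishing k' n C (tensor_power L i) (frobenius_divisor q D)) b' \<and>
            inclusion_matrix k' b' e (fst (frobenius_matrix q M))) \<and>
         int (snd (frobenius_matrix q M)) \<le> (int i + 1)\<^sup>2 * d\<^sup>2"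
proof -
  let ?\<phi> = "\<lambda>a :: 'k alg_closure. a ^ q" and ?L = "tensor_power L i"
  have k: "finite_subfield k" unfolding assms(1) by (rule finite_subfield_range_to_ac)
  have k': "finite_subfield k'" using assms(4,6) by (rule finite_subfield_if_subfield)
  have one_k: "1 \<in> k" using k by (simp add: finite_subfield_def)
  have curve: "closedin (zariski k n) C" "C \<noteq> {}" "\<And>P. P \<in> C \<Longrightarrow> smooth_curve_at n C P"
    and L: "is_line_bundle k n C L" "has_degree n C L d" and d: "d \<ge> 1"
    using assms(3) by (auto simp: projective_curve_def smooth_complete_curve_def)
  have proj: "C \<subseteq> proj_space n" using closedin_subset[OF curve(1)] topspace_zariski_subset by blast
  interpret field_automorphism ?\<phi>
    unfolding assms(2) by (rule field_automorphism_frobenius[OF k])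
  have fixed: "a ^ q = a" if "a \<in> k" for a
    unfolding assms(2) by (rule finite_subfield_power_card[OF k that])
  interpret L: equivariant_bundle ?\<phi> C L using fixed curve(1) L(1) by (rule equivariant_bundleI)
  interpret Li: equivariant_bundle ?\<phi> C ?L by (rule L.equivariant_bundle_tensor_power)
  interpret inv: equivariant_bundle "inv_into UNIV ?\<phi>" C ?L by (rule Li.equivariant_bundle_inv)

  have power_closed: "a ^ m \<in> k'" if "a \<in> k'" for a m
    using that k' by (induction m) (auto simp: finite_subfield_def)
  then have sub: "?\<phi> ` k' \<subseteq> k'" by auto
  \<comment> \<open>An injective map of a finite set into itself is onto.\<close>
  have "inj_on ?\<phi> k'" by (rule inj_onI) (simp add: inj)
  then have img: "?\<phi> ` k' = k'" by (rule card_subset_eq[OF assms(6) sub card_image])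
  have "inv_into UNIV ?\<phi> a \<in> k'" if "a \<in> k'" for a
  proof -
    have "a \<in> ?\<phi> ` k'" using that by (simp only: img)
    then show ?thesis by auto
  qed
  then have img_inv: "inv_into UNIV ?\<phi> ` k' \<subseteq> k'" by auto

  let ?S = "sections_vanishing k' n C ?L D"
  let ?S' = "sections_vanishing k' n C ?L (frobenius_divisor q D)"
  let ?b = "map conj_section b"
  have basis: "is_basis k' ?S' ?b"
  proof (rule is_basis_conj[OF img assms(10)])
    show "conj_section s \<in> ?S'" if "s \<in> ?S" for s
      unfolding frobenius_divisor_def by (rule Li.sections_vanishing_conj[OF sub that])
    \<comment> \<open>Surjectivity: the inverse Frobenius preserves \<open>k'\<close> and the bundle
      as well, and it takes the divisor back to \<open>D\<close>.\<close>
    fix s assume "s \<in> ?S'"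
    then have "inv.conj_section s \<in> sections_vanishing k' n C ?L
        (image_mset (map_point (inv_into UNIV ?\<phi>)) (frobenius_divisor q D))"
      by (rule inv.sections_vanishing_conj[OF img_inv])
    moreover have "image_mset (map_point (inv_into UNIV ?\<phi>)) (frobenius_divisor q D) = D"
      by (simp add: frobenius_divisor_def image_mset.compositionality o_def)
    moreover have "conj_section (inv.conj_section s) = s" by (rule conj_section_inv)
    ultimately show "\<exists>r\<in>?S. s = conj_section r" by metis
  qed

  have e_len: "length e = length M" and M: "\<And>r. r \<in> set M \<Longrightarrow> length r = length b \<and> set r \<subseteq> k'"
    and b_eq: "\<And>j. j < length b \<Longrightarrow> b ! j = lin_comb e (\<lambda>i. M ! i ! j)"
    using assms(11) by (auto simp: inclusion_matrix_def)
  have e_fixed: "map conj_section e = e"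
  proof (rule map_idI)
    fix s assume "s \<in> set e"
    then have s: "s \<in> global_sections k n ?L" using assms(9) by (auto simp: is_basis_def)
    have "chart ?L a \<subseteq> proj_space n" if "a < num_charts ?L" for a
      using L(1) that proj by (auto simp: is_line_bundle_def)
    then show "conj_section s = s"
      by (intro conj_section_eqI Li.global_sections_fixed[OF fixed s])
  qed
  let ?M = "map (map ?\<phi>) M"
  have "inclusion_matrix k' ?b e ?M"
    unfolding inclusion_matrix_def
  proof (intro conjI allI impI ballI)
    show "length ?M = length e" by (simp add: e_len)
    show "length r = length ?b" "set r \<subseteq> k'" if "r \<in> set ?M" for r
      using that M power_closed by fastforce+
    fix j assume "j < length ?b"
    then have j: "j < length b" by simp
    have "?b ! j = lin_comb e (?\<phi> \<circ> (\<lambda>i. M ! i ! j))"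
      using j by (simp add: b_eq conj_section_lin_comb e_fixed)
    also have "\<dots> = lin_comb e (\<lambda>i. ?M ! i ! j)"
      using e_len M j by (intro lin_comb_cong) simp
    finally show "?b ! j = lin_comb e (\<lambda>i. ?M ! i ! j)" .
  qed
  then have part1: "is_basis k' ?S' ?b \<and> inclusion_matrix k' ?b e (fst (frobenius_matrix q M))"
    using basis by (simp add: fst_frobenius_matrix)

  have d0: "0 \<le> d" using d by linarith
  then have "int (length e) \<le> int i * d + 1"
    by (intro basis_length_bound[OF k curve L _ assms(7) subset_refl assms(9)])
  \<comment> \<open>The basis \<open>b\<close> is independent only over \<open>k'\<close>, so the
    curve and the bundle are first regarded as defined over \<open>k'\<close>.\<close>
  moreover have "int (length b) \<le> int i * d + 1"
    by (rule basis_length_bound[OF k' closedin_zariski_mono[OF assms(5) one_k curve(1)] curve(2,3)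
        is_line_bundle_mono[OF assms(5) L(1)] L(2) d0 assms(7) _ assms(10)])
      (auto simp: sections_vanishing_def)
  \<comment> \<open>The summand \<open>1\<close> is absorbed because
    \<open>d \<ge> 2 * g + 1\<close> is at least \<open>1\<close>; this is the origin of the factor
    \<open>i + 1\<close>.\<close>
  moreover have "int i * d + 1 \<le> (int i + 1) * d" using d by (simp add: algebra_simps)
  ultimately have le: "int (length e) \<le> (int i + 1) * d" "int (length b) \<le> (int i + 1) * d" by simp_all
  have "map length M = map (\<lambda>_. length b) M" using M by simp
  then have "snd (frobenius_matrix q M) = length e * length b"
    unfolding snd_frobenius_matrix by (simp only: sum_list_triv e_len) simp
  then have "int (snd (frobenius_matrix q M)) = int (length e) * int (length b)" by simp
  also have "\<dots> \<le> ((int i + 1) * d) * ((int i + 1) * d)"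
    using le d0 by (intro mult_mono) auto
  also have "\<dots> = (int i + 1)\<^sup>2 * d\<^sup>2" by (simp add: power2_eq_square)
  finally show ?thesis using part1 by blast
qed

end
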